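(* Let $\{a_k\}_{k\in\mathbb{Z}}$ be a probability distribution on $\mathbb{Z}$ with mean $0$, positive variance $\eta^2$ and finite $r$-th absolute moment for some $r>4$. Let $\{p_k\}_{k\ge 0}$ be a probability distribution on $\{0,1,2,\dots\}$ with mean $1$, positive (finite) variance $\sigma^2$ and finite third moment. Let $M^n$ be the maximal displacement of the branching random walk on $\mathbb{Z}$ with step distribution $\{a_k\}$ and offspring distribution $\{p_k\}$ initiated by $n$ particles at the origin at time $0$. Then for any $x>0$, $$\lim_{n\to\infty}P\{M^n\ge\sqrt n\,x\}=1-\exp\{-C/x^2\},\qquad C=\frac{6\eta^2}{\sigma^2}.$$
   Context: Branching random walk: in each generation every particle first jumps, its displacement having law $\{a_k\}_{k\in\mathbb{Z}}$, and then at its new location is replaced by a random number of offspring with law $\{p_k\}_{k\ge0}$, all placed at that location; all jumps and offspring numbers are independent. A branching random walk initiated by $n$ particles at the origin is the superposition of $n$ independent copies of the branching random walk started from one particle at the origin. The maximal displacement is the supremum over all generations $m\ge0$ of the locations of the particles present in generation $m$ (after the reproduction step; the initial particles at time $0$ are included). *)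

theory Defs
  imports "HOL-Probability.Probability"
begin

text \<open>
  Particles carry Ulam--Harris labels \<open>(i, u)\<close>: \<open>i\<close> is the initial particle they descend from
  and \<open>u\<close> the list of birth ranks along the line of descent, so that \<open>(i, u @ [j])\<close> is
  child number \<open>j\<close> of \<open>(i, u)\<close>, and \<open>length u\<close> is the generation.
\<close>

type_synonym label = "nat \<times> nat list"

primrec generation :: "nat \<Rightarrow> (label \<Rightarrow> nat) \<Rightarrow> nat \<Rightarrow> label set" where
  "generation n children 0 = {..<n} \<times> {[]}"
| "generation n children (Suc m) =
     {(i, u @ [j]) | i u j. (i, u) \<in> generation n children m \<and> j < children (i, u)}"

text \<open>
  The value \<open>jump v\<close> is the displacement made by \<open>v\<close> itself, just before it is replaced by its
  children. The children are thus all born at the location of \<open>v\<close> plus \<open>jump v\<close>, and the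
  location of a particle sums the jumps of its proper ancestors only; the jump of a childless
  particle never contributes.
\<close>

definition location :: "(label \<Rightarrow> int) \<Rightarrow> label \<Rightarrow> int" where
  "location jump v = (\<Sum>k<length (snd v). jump (fst v, take k (snd v)))"

definition max_displacement :: "nat \<Rightarrow> (label \<Rightarrow> int) \<Rightarrow> (label \<Rightarrow> nat) \<Rightarrow> ereal" where
  "max_displacement n jump children =
     (SUP m. SUP v\<in>generation n children m. ereal (real_of_int (location jump v)))"

text \<open>
  The pairs (jump, number of children) are independent over all labels, and the law
  \<^term>\<open>pair_pmf step offspring\<close> of each pair makes its two components independent as well:
  all jumps and offspring numbers are independent. Labels with distinct first components
  give the \<open>n\<close> independent one-particle walks being superposed.
\<close>

locale branching_random_walk = prob_space M for M :: "'w measure" +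
  fixes step :: "int pmf" and offspring :: "nat pmf" and n :: nat
    and jump :: "label \<Rightarrow> 'w \<Rightarrow> int" and children :: "label \<Rightarrow> 'w \<Rightarrow> nat"
  assumes indep: "indep_vars (\<lambda>_. count_space UNIV) (\<lambda>v \<omega>. (jump v \<omega>, children v \<omega>))
      ({..<n} \<times> UNIV)"
    and law: "v \<in> {..<n} \<times> UNIV \<Longrightarrow>
      distr M (count_space UNIV) (\<lambda>\<omega>. (jump v \<omega>, children v \<omega>)) =
        measure_pmf (pair_pmf step offspring)"

end

theory Submission
  imports Defs "HOL-Real_Asymp.Real_Asymp"
begin

text \<open>
  Write \<open>u k\<close> for the probability that the walk started from one particle reaches \<open>k\<close>. Conditioning
  on the first jump \<open>J\<close> and the number \<open>N\<close> of children gives \<open>u k = E Q (u (k - J))\<close> for \<open>k > 0\<close>, where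
  \<open>Q s = E (1 - (1 - s) ^ N)\<close> (here \<open>thinning p s\<close>) is a strict contraction with
  \<open>Q s = s - \<sigma>\<^sup>2 / 2 * s\<^sup>2 + O(s\<^sup>3)\<close>. Strict contraction yields a maximum principle, and \<open>u\<close> tends to \<open>0\<close> because \<open>0\<close> is the only fixed point
  of \<open>Q\<close>. Since \<open>c / y\<^sup>2\<close> has second derivative \<open>6 * c / y ^ 4\<close>, it is, far out, a supersolution for
  \<open>c > 6 * \<eta>\<^sup>2 / \<sigma>\<^sup>2\<close> and a subsolution for \<open>c < 6 * \<eta>\<^sup>2 / \<sigma>\<^sup>2\<close>. Suitable shifts of such functions therefore
  enclose \<open>u\<close>, so that \<open>k\<^sup>2 * u k\<close> tends to \<open>6 * \<eta>\<^sup>2 / \<sigma>\<^sup>2\<close>. Finally, \<open>n\<close> independent copies stay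
  below \<open>k\<close> with probability \<open>(1 - u k) ^ n\<close>.
\<close>

section \<open>The offspring operator\<close>

text \<open>The probability that at least one of \<open>N\<close> offspring is marked when each is
  marked independently with probability \<open>s\<close>; in terms of the generating function
  \<open>g\<close> it is \<open>1 - g (1 - s)\<close>.\<close>

definition thinning :: "nat pmf \<Rightarrow> real \<Rightarrow> real" where
  "thinning p s = measure_pmf.expectation p (\<lambda>N. 1 - (1 - s) ^ N)"

lemma integrable_pmf_bounded:
  fixes f :: "'a \<Rightarrow> real"
  assumes "\<And>x. \<bar>f x\<bar> \<le> b"
  shows "integrable (measure_pmf q) f"
  by (rule measure_pmf.integrable_const_bound[where B = b]) (use assms in auto)

lemma integrable_thinning:
  assumes "0 \<le> (s::real)" "s \<le> 1"
  shows "integrable (measure_pmf p) (\<lambda>N. 1 - (1 - s) ^ N)"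
  by (rule integrable_pmf_bounded[where b = 1]) (use assms in \<open>simp add: power_le_one\<close>)

lemma integrable_power_one_minus:
  assumes "0 \<le> (s::real)" "s \<le> 1"
  shows "integrable (measure_pmf p) (\<lambda>N. (1 - s) ^ N)"
  by (rule integrable_pmf_bounded[where b = 1]) (use assms in \<open>simp add: power_le_one\<close>)

lemma thinning_eq:
  assumes "0 \<le> s" "s \<le> 1"
  shows "thinning p s = 1 - measure_pmf.expectation p (\<lambda>N. (1 - s) ^ N)"
  unfolding thinning_def using integrable_power_one_minus[OF assms] by simp

lemma thinning_0: "thinning p 0 = 0"
  by (simp add: thinning_def)

lemma thinning_nonneg: "0 \<le> s \<Longrightarrow> s \<le> 1 \<Longrightarrow> 0 \<le> thinning p s"
  unfolding thinning_def by (intro integral_nonneg_AE) (auto simp: power_le_one)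

lemma thinning_le_1: "0 \<le> s \<Longrightarrow> s \<le> 1 \<Longrightarrow> thinning p s \<le> 1"
  unfolding thinning_def
  by (rule measure_pmf.integral_le_const) (auto intro: integrable_thinning)

lemma abs_thinning_le_1: "0 \<le> s \<Longrightarrow> s \<le> 1 \<Longrightarrow> \<bar>thinning p s\<bar> \<le> 1"
  using thinning_nonneg[of s p] thinning_le_1[of s p] by simp

lemma thinning_mono:
  assumes "0 \<le> s" "s \<le> t" "t \<le> 1"
  shows "thinning p s \<le> thinning p t"
  unfolding thinning_def using assms
  by (intro integral_mono integrable_thinning) (auto intro: power_mono)

lemma integrable_thinning_comp:
  assumes "\<And>k. 0 \<le> v k" "\<And>k. v k \<le> 1"
  shows "integrable (measure_pmf q) (\<lambda>j. thinning p (v (f j)))"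
proof (rule integrable_pmf_bounded)
  show "\<bar>thinning p (v (f j))\<bar> \<le> 1" for j
    using assms thinning_nonneg[of "v (f j)" p] thinning_le_1[of "v (f j)" p] by (simp add: abs_le_iff)
qed

text \<open>The slope of \<open>(1 - s) ^ N\<close> is at most \<open>N\<close> in absolute value on
  the unit interval. The induction splits off one factor and bounds the remaining ones by 1.\<close>

lemma power_one_minus_diff_le:
  fixes s t :: real
  assumes "0 \<le> s" "s \<le> t" "t \<le> 1"
  shows "(1 - s) ^ N - (1 - t) ^ N \<le> real N * (t - s)"
proof (induction N)
  case (Suc N)
  have "(1 - s) ^ Suc N - (1 - t) ^ Suc N
      = (1 - s) * ((1 - s) ^ N - (1 - t) ^ N) + (t - s) * (1 - t) ^ N"
    by (simp add: algebra_simps)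
  also have "\<dots> \<le> 1 * (real N * (t - s)) + (t - s) * 1"
    using assms Suc by (intro add_mono mult_mono) (auto simp: power_le_one power_mono)
  finally show ?case by (simp add: algebra_simps)
qed simp

text \<open>The strict inequality comes from \<open>(1 - t) ^ n < 1\<close>, which needs an exponent
  of at least 1 after one factor is split off; for \<open>N\<close> equal to 0 or 1 the two sides
  agree.\<close>

lemma power_one_minus_diff_less:
  fixes s t :: real
  assumes "0 \<le> s" "s < t" "t \<le> 1" "2 \<le> N"
  shows "(1 - s) ^ N - (1 - t) ^ N < real N * (t - s)"
proof -
  obtain n where N: "N = Suc n" "1 \<le> n" using \<open>2 \<le> N\<close> by (cases N) auto
  have *: "(1 - t) ^ n < 1"
    using assms N by (intro power_less_one_iff[THEN iffD2]) auto
  have "(1 - s) ^ Suc n - (1 - t) ^ Suc n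
      = (1 - s) * ((1 - s) ^ n - (1 - t) ^ n) + (t - s) * (1 - t) ^ n"
    by (simp add: algebra_simps)
  also have "\<dots> < 1 * (real n * (t - s)) + (t - s) * 1"
    using assms power_one_minus_diff_le[of s t n] *
    by (intro add_le_less_mono mult_mono mult_strict_left_mono) (auto simp: power_mono)
  finally show ?thesis by (simp add: N algebra_simps)
qed

text \<open>\<open>b2\<close> and \<open>b3\<close> are the binomial coefficients
  \<open>N choose 2\<close> and \<open>N choose 3\<close>. Passing from \<open>N\<close> to
  \<open>N + 1\<close> subtracts \<open>s * (1 - s) ^ N\<close>, so each bound follows from itself
  at \<open>N\<close> and the opposite bound of one order lower, by Pascal's rule.\<close>

lemma bonferroni_power:
  fixes s :: real
  assumes "0 \<le> s" "s \<le> 1"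
  defines "b2 \<equiv> \<lambda>N. real N * (real N - 1) / 2"
    and "b3 \<equiv> \<lambda>N. real N * (real N - 1) * (real N - 2) / 6"
  shows "(1 - s) ^ N \<le> 1 - N * s + b2 N * s\<^sup>2"
    and "1 - N * s + b2 N * s\<^sup>2 - b3 N * s ^ 3 \<le> (1 - s) ^ N"
proof -
  have nonneg: "0 \<le> b2 N" "0 \<le> b3 N" for N
  proof -
    consider "N = 0" | "N = 1" | "2 \<le> N" by linarith
    then show "0 \<le> b2 N" "0 \<le> b3 N" by (cases; simp add: b2_def b3_def)+
  qed
  have 1: "1 - N * s \<le> (1 - s) ^ N" for N
    using power_one_minus_diff_le[of 0 s N] assms(1,2) by simp
  have "1 - N * s \<le> (1 - s) ^ N \<and> (1 - s) ^ N \<le> 1 - N * s + b2 N * s\<^sup>2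
      \<and> 1 - N * s + b2 N * s\<^sup>2 - b3 N * s ^ 3 \<le> (1 - s) ^ N" for N
  proof (induction N)
    case 0
    then show ?case by (simp add: b2_def b3_def)
  next
    case (Suc N)
    have step: "(1 - s) ^ Suc N = (1 - s) ^ N - s * (1 - s) ^ N"
      by (simp add: algebra_simps)
    have "s * (1 - N * s) \<le> s * (1 - s) ^ N"
      using 1[of N] assms(1) by (intro mult_left_mono) auto
    then have "(1 - s) ^ Suc N \<le> 1 - N * s + b2 N * s\<^sup>2 - s * (1 - N * s)"
      unfolding step using Suc by linarith
    also have "\<dots> = 1 - Suc N * s + b2 (Suc N) * s\<^sup>2"
      by (simp add: b2_def field_simps power2_eq_square)
    finally have upper: "(1 - s) ^ Suc N \<le> 1 - Suc N * s + b2 (Suc N) * s\<^sup>2" .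
    have "s * (1 - s) ^ N \<le> s * (1 - N * s + b2 N * s\<^sup>2)"
      using Suc assms(1) by (intro mult_left_mono) auto
    then have "1 - N * s + b2 N * s\<^sup>2 - b3 N * s ^ 3 - s * (1 - N * s + b2 N * s\<^sup>2) \<le> (1 - s) ^ Suc N"
      unfolding step using Suc by linarith
    also have "1 - N * s + b2 N * s\<^sup>2 - b3 N * s ^ 3 - s * (1 - N * s + b2 N * s\<^sup>2)
        = 1 - Suc N * s + b2 (Suc N) * s\<^sup>2 - b3 (Suc N) * s ^ 3"
      by (simp add: b2_def b3_def field_simps power2_eq_square power3_eq_cube)
    finally show ?case using upper 1 by blast
  qed
  then show "(1 - s) ^ N \<le> 1 - N * s + b2 N * s\<^sup>2"
    and "1 - N * s + b2 N * s\<^sup>2 - b3 N * s ^ 3 \<le> (1 - s) ^ N" by blast+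
qed

lemma integrable_pmf_lower_power:
  fixes f :: "'a \<Rightarrow> real"
  assumes "integrable (measure_pmf q) (\<lambda>k. \<bar>f k\<bar> ^ m)" "l \<le> m"
  shows "integrable (measure_pmf q) (\<lambda>k. f k ^ l)"
proof (rule Bochner_Integration.integrable_bound)
  show "integrable (measure_pmf q) (\<lambda>k. 1 + \<bar>f k\<bar> ^ m)" using assms(1) by simp
  have "\<bar>f k\<bar> ^ l \<le> 1 + \<bar>f k\<bar> ^ m" for k
  proof (cases "\<bar>f k\<bar> \<le> 1")
    case True
    then have "\<bar>f k\<bar> ^ l \<le> 1" by (simp add: power_le_one)
    then show ?thesis by (simp add: add_increasing2)
  next
    case False
    then have "\<bar>f k\<bar> ^ l \<le> \<bar>f k\<bar> ^ m" using assms(2) by (intro power_increasing) auto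
    then show ?thesis by simp
  qed
  then show "AE k in measure_pmf q. norm (f k ^ l) \<le> norm (1 + \<bar>f k\<bar> ^ m)"
    by (auto simp: power_abs intro!: AE_pmfI)
qed simp

section \<open>Maximum principle\<close>

text \<open>The parameters are the variances themselves. A fourth moment of the step law fits the
  barriers, whose defects are of order \<open>y ^ -4\<close>; a third moment of the offspring law
  controls the cubic remainder of \<open>thinning\<close>.\<close>

locale critical_laws =
  fixes a :: "int pmf" and p :: "nat pmf" and \<eta>2 \<sigma>2 :: real
  assumes step_moment: "integrable (measure_pmf a) (\<lambda>k. real_of_int k ^ 4)"
    and step_mean: "measure_pmf.expectation a real_of_int = 0"
    and step_variance: "measure_pmf.variance a real_of_int = \<eta>2"
    and \<eta>2_pos: "\<eta>2 > 0"
    and offspring_moment: "integrable (measure_pmf p) (\<lambda>k. real k ^ 3)"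
    and offspring_mean: "measure_pmf.expectation p real = 1"
    and offspring_variance: "measure_pmf.variance p real = \<sigma>2"
    and \<sigma>2_pos: "\<sigma>2 > 0"
begin

lemma integrable_step: "l \<le> 4 \<Longrightarrow> integrable (measure_pmf a) (\<lambda>k. real_of_int k ^ l)"
  using integrable_pmf_lower_power[of a real_of_int 4 l] step_moment by simp

lemma integrable_step1 [simp]: "integrable (measure_pmf a) real_of_int"
  using integrable_step[of 1] by simp

lemma integrable_offspring: "l \<le> 3 \<Longrightarrow> integrable (measure_pmf p) (\<lambda>k. real k ^ l)"
  using integrable_pmf_lower_power[of p real 3 l] offspring_moment by simp

lemma integrable_offspring1 [simp]: "integrable (measure_pmf p) real"
  using integrable_offspring[of 1] by simp

lemma step_second_moment: "measure_pmf.expectation a (\<lambda>k. real_of_int k ^ 2) = \<eta>2"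
  using step_variance by (simp add: step_mean)

lemma offspring_second_moment: "measure_pmf.expectation p (\<lambda>k. real k ^ 2) = 1 + \<sigma>2"
proof -
  have "\<sigma>2 = measure_pmf.expectation p (\<lambda>k. real k ^ 2) - 1"
    using measure_pmf.variance_eq[of p real] integrable_offspring[of 2] offspring_variance
    by (simp add: offspring_mean)
  then show ?thesis by simp
qed

text \<open>Otherwise \<open>N\<^sup>2 = N\<close> almost surely, so the second moment would equal
  the mean 1 instead of \<open>1 + \<sigma>2\<close>.\<close>

lemma offspring_ge_2: "\<exists>N. pmf p N > 0 \<and> 2 \<le> N"
proof (rule ccontr)
  assume "\<not> ?thesis"
  then have "N \<in> {0, 1}" if "N \<in> set_pmf p" for N
    using that by (auto simp: set_pmf_iff pmf_positive_iff not_le less_Suc_eq numeral_2_eq_2)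
  then have "AE N in measure_pmf p. real N ^ 2 = real N"
    by (intro AE_pmfI) fastforce
  then have "measure_pmf.expectation p (\<lambda>k. real k ^ 2) = measure_pmf.expectation p real"
    by (intro integral_cong_AE) auto
  then show False using offspring_second_moment offspring_mean \<sigma>2_pos by simp
qed

text \<open>The expectation of the pointwise bound \<open>real N * (t - s)\<close> is
  \<open>t - s\<close> because the mean is 1. The inequality is strict at an atom
  \<open>N \<ge> 2\<close>, so the nonnegative difference \<open>?D\<close> cannot have expectation
  0.\<close>

lemma thinning_contraction:
  assumes "0 \<le> s" "s < t" "t \<le> 1"
  shows "thinning p t - thinning p s < t - s"
proof -
  let ?D = "\<lambda>N. real N * (t - s) - ((1 - s) ^ N - (1 - t) ^ N)"
  have ints: "integrable (measure_pmf p) (\<lambda>N. (1 - s) ^ N)" "integrable (measure_pmf p) (\<lambda>N. (1 - t) ^ N)"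
    using assms by (auto intro!: integrable_power_one_minus)
  then have int: "integrable (measure_pmf p) ?D" by simp
  have "measure_pmf.expectation p ?D = (t - s) - (thinning p t - thinning p s)"
    using ints assms by (simp add: thinning_eq offspring_mean)
  moreover have "0 < measure_pmf.expectation p ?D"
  proof -
    have nonneg: "0 \<le> ?D N" for N
      using power_one_minus_diff_le[of s t N] assms by simp
    obtain N where N: "pmf p N > 0" "2 \<le> N" using offspring_ge_2 by blast
    have "?D N > 0" using power_one_minus_diff_less[of s t N] assms N by simp
    have "measure_pmf.expectation p ?D \<noteq> 0"
    proof
      assume "measure_pmf.expectation p ?D = 0"
      then have "AE N in measure_pmf p. ?D N = 0"
        using integral_nonneg_eq_0_iff_AE[OF int] nonneg by auto
      then have "?D N = 0" using N by (auto simp: AE_measure_pmf_iff set_pmf_iff)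
      then show False using \<open>?D N > 0\<close> by simp
    qed
    moreover have "0 \<le> measure_pmf.expectation p ?D"
      using nonneg by (intro integral_nonneg_AE) auto
    ultimately show ?thesis by simp
  qed
  ultimately show ?thesis by simp
qed

text \<open>The expectation of \<open>N choose 3\<close>, the coefficient of the cubic
  remainder.\<close>

definition "\<tau> = measure_pmf.expectation p (\<lambda>N. real N * (real N - 1) * (real N - 2) / 6)"

text \<open>Expectations of the two Bonferroni bounds: mean 1 gives the linear term
  \<open>s\<close>, and the expectation of \<open>N choose 2\<close> is
  \<open>(1 + \<sigma>2 - 1) / 2\<close>.\<close>

lemma thinning_bounds:
  assumes "0 \<le> s" "s \<le> 1"
  shows "s - \<sigma>2 / 2 * s\<^sup>2 \<le> thinning p s"
    and "thinning p s \<le> s - \<sigma>2 / 2 * s\<^sup>2 + \<tau> * s ^ 3"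
proof -
  let ?b2 = "\<lambda>N. real N * (real N - 1) / 2"
  let ?b3 = "\<lambda>N. real N * (real N - 1) * (real N - 2) / 6"
  have b2: "?b2 = (\<lambda>N. (real N ^ 2 - real N) / 2)"
    by (auto simp: fun_eq_iff algebra_simps power2_eq_square)
  have b3: "?b3 = (\<lambda>N. (real N ^ 3 - 3 * real N ^ 2 + 2 * real N) / 6)"
    by (auto simp: fun_eq_iff algebra_simps power2_eq_square power3_eq_cube)
  have int2: "integrable (measure_pmf p) ?b2" and int3: "integrable (measure_pmf p) ?b3"
    unfolding b2 b3 using integrable_offspring[of 2] integrable_offspring[of 3] by auto
  have E2: "measure_pmf.expectation p ?b2 = \<sigma>2 / 2"
    unfolding b2 using integrable_offspring[of 2]
    by (simp add: offspring_second_moment offspring_mean)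
  have "measure_pmf.expectation p (\<lambda>N. real N * s - ?b2 N * s\<^sup>2) \<le> thinning p s"
    unfolding thinning_def
    using bonferroni_power(1)[OF assms] int2 integrable_power_one_minus[OF assms]
    by (intro integral_mono Bochner_Integration.integrable_diff integrable_mult_left) (auto simp: algebra_simps)
  then show "s - \<sigma>2 / 2 * s\<^sup>2 \<le> thinning p s"
    by (simp only: Bochner_Integration.integral_diff integrable_mult_left int2 E2
        integral_mult_left_zero integrable_offspring1 offspring_mean mult_1)
  have "thinning p s \<le> measure_pmf.expectation p (\<lambda>N. real N * s - ?b2 N * s\<^sup>2 + ?b3 N * s ^ 3)"
    unfolding thinning_def
    using bonferroni_power(2)[OF assms] int2 int3 integrable_power_one_minus[OF assms]
    by (intro integral_mono Bochner_Integration.integrable_diff Bochner_Integration.integrable_add integrable_mult_left)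
      (auto simp: algebra_simps)
  then show "thinning p s \<le> s - \<sigma>2 / 2 * s\<^sup>2 + \<tau> * s ^ 3"
    by (simp only: Bochner_Integration.integral_add Bochner_Integration.integral_diff
        Bochner_Integration.integrable_diff integrable_mult_left int2 int3 E2 \<tau>_def[symmetric]
        integral_mult_left_zero integrable_offspring1 offspring_mean mult_1)
qed

text \<open>If \<open>v - u\<close> were positive somewhere, it would attain a positive maximum
  \<open>\<delta>\<close> at some \<open>m > K\<close>. There the two inequalities bound
  \<open>\<delta>\<close> by the mean of \<open>thinning p (v _) - thinning p (u _)\<close>, which
  strict contraction makes smaller than \<open>\<delta>\<close>.\<close>

lemma comparison_principle:
  fixes u v :: "int \<Rightarrow> real"
  assumes u: "\<And>k. 0 \<le> u k" "\<And>k. u k \<le> 1"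
    and v: "\<And>k. 0 \<le> v k" "\<And>k. v k \<le> 1"
    and boundary: "\<And>k. k \<le> K \<Longrightarrow> v k \<le> u k"
    and sub: "\<And>k. k > K \<Longrightarrow> v k \<le> measure_pmf.expectation a (\<lambda>j. thinning p (v (k - j)))"
    and super: "\<And>k. k > K \<Longrightarrow> measure_pmf.expectation a (\<lambda>j. thinning p (u (k - j))) \<le> u k"
    and decay: "(v \<longlongrightarrow> 0) at_top"
  shows "v k \<le> u k"
proof (rule ccontr)
  assume "\<not> v k \<le> u k"
  define \<delta>0 where "\<delta>0 = v k - u k"
  have "\<delta>0 > 0" and "k > K" using \<open>\<not> v k \<le> u k\<close> boundary[of k] by (auto simp: \<delta>0_def intro: leI)
  \<comment> \<open>Decay of \<open>v\<close> reduces the search for a maximum to a finite interval: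
    beyond \<open>L\<close> the difference is below \<open>\<delta>0\<close>, and up to
    \<open>K\<close> it is nonpositive. The interval contains \<open>k\<close>, so its maximum is at
    least \<open>\<delta>0\<close> and is a global one.\<close>
  obtain L where L: "v l < \<delta>0" if "l \<ge> L" for l
    using order_tendstoD(2)[OF decay \<open>\<delta>0 > 0\<close>] by (auto simp: eventually_at_top_linorder)
  let ?S = "{K<..max L k}"
  have "finite ?S" "?S \<noteq> {}" using \<open>k > K\<close> by auto
  then obtain m where m: "m \<in> ?S" "Max ((\<lambda>l. v l - u l) ` ?S) = v m - u m"
    by (rule obtains_MAX)
  have max: "v l - u l \<le> v m - u m" if "l \<in> ?S" for l
    unfolding m(2)[symmetric] using that by (intro Max_ge) auto
  define \<delta> where "\<delta> = v m - u m"
  have "\<delta>0 \<le> \<delta>" using max[of k] \<open>k > K\<close> by (simp add: \<delta>_def \<delta>0_def)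
  have le: "v l - u l \<le> \<delta>" for l
  proof -
    consider "l \<le> K" | "l \<in> ?S" | "l \<ge> L" by fastforce
    then show ?thesis
    proof cases
      case 1
      then show ?thesis using boundary[of l] \<open>\<delta>0 > 0\<close> \<open>\<delta>0 \<le> \<delta>\<close> by linarith
    next
      case 2
      then show ?thesis using max[of l] by (simp add: \<delta>_def)
    next
      case 3
      then show ?thesis using L[of l] u(1)[of l] \<open>\<delta>0 \<le> \<delta>\<close> by linarith
    qed
  qed
  \<comment> \<open>Where \<open>v\<close> exceeds \<open>u\<close>, contraction loses strictly
    against a difference of at most \<open>\<delta>\<close>; elsewhere monotonicity makes the left
    side nonpositive.\<close>
  have less: "thinning p (v l) - thinning p (u l) < \<delta>" for l
  proof (cases "u l < v l")
    case True
    then show ?thesis using thinning_contraction[OF u(1) True v(2)] le[of l] by linarith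
  next
    case False
    then show ?thesis
      using thinning_mono[OF v(1) _ u(2), of l l p] \<open>\<delta>0 > 0\<close> \<open>\<delta>0 \<le> \<delta>\<close> by linarith
  qed
  have int: "integrable (measure_pmf a) (\<lambda>j. thinning p (v (m - j)))"
    "integrable (measure_pmf a) (\<lambda>j. thinning p (u (m - j)))"
    using integrable_thinning_comp[OF v, of a p "\<lambda>j. m - j"]
      integrable_thinning_comp[OF u, of a p "\<lambda>j. m - j"] by simp_all
  have "\<delta> \<le> measure_pmf.expectation a (\<lambda>j. thinning p (v (m - j)))
      - measure_pmf.expectation a (\<lambda>j. thinning p (u (m - j)))"
    using sub[of m] super[of m] m(1) by (simp add: \<delta>_def)
  also have "\<dots> = measure_pmf.expectation a (\<lambda>j. thinning p (v (m - j)) - thinning p (u (m - j)))"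
    using int by simp
  also have "\<dots> < \<delta>"
    using less int by (intro measure_pmf.expectation_less) auto
  finally show False by simp
qed

end

section \<open>Barriers\<close>

text \<open>The power series \<open>1 + 2 * t + 3 * t\<^sup>2 + ...\<close> cut after the cubic
  term, with a quartic term for the remainder. Negative \<open>t\<close> of any size is covered; the
  constant 12 gives equality at \<open>t = 1 / 2\<close>.\<close>

lemma inverse_square_upper:
  fixes t :: real
  assumes "t \<le> 1 / 2"
  shows "1 / (1 - t)\<^sup>2 \<le> 1 + 2 * t + 3 * t\<^sup>2 + 4 * t ^ 3 + 12 * t ^ 4"
proof -
  have "(1 + 2 * t + 3 * t\<^sup>2 + 4 * t ^ 3 + 12 * t ^ 4) * (1 - t)\<^sup>2 - 1
      = t ^ 4 * ((1 - 2 * t) * (7 - 6 * t))"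
    by (simp add: algebra_simps power2_eq_square power3_eq_cube power4_eq_xxxx)
  also have "\<dots> \<ge> 0"
    using assms by (intro mult_nonneg_nonneg) auto
  finally show ?thesis using assms by (simp add: divide_le_eq)
qed

lemma inverse_square_lower:
  fixes t :: real
  assumes "t \<le> 1 / 2"
  shows "1 + 2 * t + 3 * t\<^sup>2 + 4 * t ^ 3 \<le> 1 / (1 - t)\<^sup>2"
proof -
  have "1 - (1 + 2 * t + 3 * t\<^sup>2 + 4 * t ^ 3) * (1 - t)\<^sup>2 = t ^ 4 * (5 - 4 * t)"
    by (simp add: algebra_simps power2_eq_square power3_eq_cube power4_eq_xxxx)
  also have "\<dots> \<ge> 0"
    using assms by (intro mult_nonneg_nonneg) auto
  finally show ?thesis using assms by (simp add: le_divide_eq)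
qed

text \<open>A majorant of degree two, so that its square has degree four and is integrable under a
  fourth moment. The constant 8 gives equality at \<open>t = 1 / 2\<close>.\<close>

lemma inverse_square_upper_quadratic:
  fixes t :: real
  assumes "t \<le> 1 / 2"
  shows "1 / (1 - t)\<^sup>2 \<le> 1 + 2 * t + 8 * t\<^sup>2"
proof -
  have "(1 + 2 * t + 8 * t\<^sup>2) * (1 - t)\<^sup>2 - 1 = t\<^sup>2 * ((1 - 2 * t) * (5 - 4 * t))"
    by (simp add: algebra_simps power2_eq_square)
  also have "\<dots> \<ge> 0"
    using assms by (intro mult_nonneg_nonneg) auto
  finally show ?thesis using assms by (simp add: divide_le_eq)
qed

text \<open>Each power is at most \<open>2 * t\<close> times itself, so the four terms are bounded
  by 16, 16, 12 and 8 times \<open>t ^ 4\<close>. With \<open>- 52 * t ^ 4\<close> added, the cubic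
  becomes a minorant of any nonnegative function for \<open>t > 1 / 2\<close>.\<close>

lemma cubic_le_quartic:
  fixes t :: real
  assumes "1 / 2 < t"
  shows "1 + 2 * t + 3 * t\<^sup>2 + 4 * t ^ 3 \<le> 52 * t ^ 4"
proof -
  have "t ^ 4 = t * t ^ 3" "t ^ 3 = t * t\<^sup>2" "t\<^sup>2 = t * t"
    by (simp_all add: power2_eq_square power3_eq_cube power4_eq_xxxx)
  moreover have "1 \<le> 2 * t" using assms by simp
  moreover have "t \<le> 2 * t * t" "t\<^sup>2 \<le> 2 * t * t\<^sup>2" "t ^ 3 \<le> 2 * t * t ^ 3"
    using assms by (auto simp: mult_le_cancel_right1)
  ultimately show ?thesis by linarith
qed

text \<open>Freezing the value below \<open>S\<close> removes the pole and, once
  \<open>c \<le> S\<^sup>2\<close>, keeps all values in the unit interval where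
  \<open>thinning\<close> is controlled.\<close>

definition inv_square :: "real \<Rightarrow> int \<Rightarrow> int \<Rightarrow> real" where
  "inv_square c S y = c / (real_of_int (max y S))\<^sup>2"

lemma inv_square_nonneg: "0 \<le> c \<Longrightarrow> 0 \<le> inv_square c S y"
  by (simp add: inv_square_def)

lemma inv_square_le_1:
  assumes "0 \<le> c" "0 < S" "c \<le> (real_of_int S)\<^sup>2"
  shows "inv_square c S y \<le> 1"
proof -
  have "(real_of_int S)\<^sup>2 \<le> (real_of_int (max y S))\<^sup>2"
    using assms by (intro power_mono) auto
  then have "c \<le> (real_of_int (max y S))\<^sup>2" using assms by linarith
  then show ?thesis by (simp add: inv_square_def divide_le_eq)
qed

text \<open>
  The value \<open>1\<close> on the left dominates whatever is not known about the solution there. On the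
  plateau \<open>0 < y \<le> S\<close> only the solution being below \<open>c / S\<^sup>2\<close> is needed, which convergence to \<open>0\<close>
  guarantees after a shift; in return, \<open>c / y\<^sup>2\<close> has to be a supersolution only for large \<open>y\<close>.
\<close>

definition barrier :: "real \<Rightarrow> int \<Rightarrow> int \<Rightarrow> real" where
  "barrier c S y = (if y \<le> 0 then 1 else inv_square c S y)"

lemma barrier_bounds:
  assumes "0 \<le> c" "0 < S" "c \<le> (real_of_int S)\<^sup>2"
  shows "0 \<le> barrier c S y" "barrier c S y \<le> 1" "inv_square c S y \<le> barrier c S y"
  using inv_square_nonneg[of c S y] inv_square_le_1[OF assms, of y] assms(1) by (auto simp: barrier_def)

lemma inv_square_tendsto_0: "((\<lambda>y. inv_square c S (y - b)) \<longlongrightarrow> 0) at_top"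
proof -
  have "filterlim (\<lambda>y::int. real_of_int y) at_top at_top"
    by (rule filterlim_real_of_int_at_top)
  moreover have "((\<lambda>y. c / (y - real_of_int b)\<^sup>2) \<longlongrightarrow> 0) at_top"
    by real_asymp
  ultimately have "((\<lambda>y::int. c / (real_of_int y - real_of_int b)\<^sup>2) \<longlongrightarrow> 0) at_top"
    by (rule filterlim_compose[rotated])
  moreover have "eventually (\<lambda>y. c / (real_of_int y - real_of_int b)\<^sup>2 = inv_square c S (y - b)) at_top"
    using eventually_ge_at_top[of "S + b"] by eventually_elim (auto simp: inv_square_def)
  ultimately show ?thesis by (rule Lim_transform_eventually)
qed

text \<open>Multiplication by \<open>y ^ 4\<close> turns the error terms of the barriers into
  expressions in \<open>1 / y\<close> and \<open>y\<^sup>2 * s\<close>, whose limits are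
  known.\<close>

lemma rescale_quartic:
  fixes y :: real assumes "y \<noteq> 0"
  shows "y ^ 4 * (c / y\<^sup>2 * (p / y\<^sup>2 + q / y ^ 3 + r / y ^ 4)) = c * (p + q * (1 / y) + r * (1 / y)\<^sup>2)"
  using assms by (simp add: distrib_left power_divide power2_eq_square power3_eq_cube power4_eq_xxxx)
lemma rescale_square:
  fixes y :: real assumes "y \<noteq> 0"
  shows "y ^ 4 * (p * s\<^sup>2 - q * s ^ 3) = p * (y\<^sup>2 * s)\<^sup>2 - q * (y\<^sup>2 * s) ^ 3 * (1 / y)\<^sup>2"
  using assms by (simp add: right_diff_distrib power2_eq_square power3_eq_cube power4_eq_xxxx)

section \<open>Moments and tail of the step law, and the two barrier inequalities\<close>

context critical_laws
begin

definition "\<mu>3 = measure_pmf.expectation a (\<lambda>j. real_of_int j ^ 3)"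
definition "\<mu>4 = measure_pmf.expectation a (\<lambda>j. real_of_int j ^ 4)"

text \<open>The term with \<open>b1\<close> vanishes because the steps have mean 0.\<close>

lemma quartic_expectation:
  fixes y b0 b1 b2 b3 b4 :: real
  defines "f \<equiv> \<lambda>j::int. b0 + b1 * (j / y) + b2 * (j / y)\<^sup>2 + b3 * (j / y) ^ 3 + b4 * (j / y) ^ 4"
  shows "integrable (measure_pmf a) f"
    and "measure_pmf.expectation a f = b0 + b2 * \<eta>2 / y\<^sup>2 + b3 * \<mu>3 / y ^ 3 + b4 * \<mu>4 / y ^ 4"
  using integrable_step[of 2] integrable_step[of 3] integrable_step[of 4]
  by (simp_all add: f_def power_divide step_mean step_second_moment \<mu>3_def \<mu>4_def)

definition "tail y = measure_pmf.prob a {j. real_of_int j > y / 2}"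

lemma tail_eq: "tail y = measure_pmf.expectation a (\<lambda>j. indicator {j. real_of_int j > y / 2} j)"
  by (simp add: tail_def)

text \<open>A refined Markov inequality: on the event \<open>j > y / 2\<close> one has
  \<open>y ^ 4 \<le> 16 * j ^ 4\<close>, and the truncated fourth moment tends to 0 by dominated
  convergence. The tail is thus negligible at the deciding order \<open>y ^ -4\<close>.\<close>

lemma tail_tendsto: "((\<lambda>y. y ^ 4 * tail y) \<longlongrightarrow> 0) at_top"
proof -
  have "((\<lambda>y. measure_pmf.expectation a (\<lambda>j. 16 * real_of_int j ^ 4 * indicator {j. real_of_int j > y / 2} j))
      \<longlongrightarrow> measure_pmf.expectation a (\<lambda>j. 0)) at_top"
  proof (rule integral_dominated_convergence_at_top[where w = "\<lambda>j. 16 * real_of_int j ^ 4"])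
    show "AE j in measure_pmf a. ((\<lambda>y. 16 * real_of_int j ^ 4 * indicator {j. real_of_int j > y / 2} j) \<longlongrightarrow> 0) at_top"
    proof (rule AE_pmfI)
      fix j
      have "eventually (\<lambda>y. 0 = 16 * real_of_int j ^ 4 * indicator {j. real_of_int j > y / 2} j) at_top"
        using eventually_ge_at_top[of "2 * real_of_int j"] by eventually_elim auto
      then show "((\<lambda>y. 16 * real_of_int j ^ 4 * indicator {j. real_of_int j > y / 2} j) \<longlongrightarrow> 0) at_top"
        by (rule Lim_transform_eventually[OF tendsto_const])
    qed
  qed (use integrable_step[of 4] in \<open>auto simp: indicator_def\<close>)
  then have lim: "((\<lambda>y. measure_pmf.expectation a (\<lambda>j. 16 * real_of_int j ^ 4 * indicator {j. real_of_int j > y / 2} j))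
      \<longlongrightarrow> 0) at_top" by simp
  show ?thesis
  proof (rule tendsto_sandwich[OF _ _ tendsto_const lim])
    show "eventually (\<lambda>y. 0 \<le> y ^ 4 * tail y) at_top"
      using eventually_ge_at_top[of 0] by eventually_elim (simp add: tail_def)
    show "eventually (\<lambda>y. y ^ 4 * tail y \<le> measure_pmf.expectation a
        (\<lambda>j. 16 * real_of_int j ^ 4 * indicator {j. real_of_int j > y / 2} j)) at_top"
      using eventually_ge_at_top[of 0]
    proof eventually_elim
      case (elim y)
      have "y ^ 4 \<le> 16 * real_of_int j ^ 4" if "real_of_int j > y / 2" for j
        using power_mono[of y "2 * real_of_int j" 4] that elim by (simp add: power_mult_distrib)
      then have "measure_pmf.expectation a (\<lambda>j. y ^ 4 * indicator {j. real_of_int j > y / 2} j)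
          \<le> measure_pmf.expectation a (\<lambda>j. 16 * real_of_int j ^ 4 * indicator {j. real_of_int j > y / 2} j)"
        using integrable_step[of 4]
        by (intro integral_mono integrable_real_mult_indicator) (auto simp: indicator_def)
      then show ?case by (simp add: tail_eq)
    qed
  qed
qed

text \<open>The nonlinear part of \<open>thinning\<close>. The linear part only averages over a
  step; the loss is increasing by the contraction property, so bounds on the barrier transfer to
  it.\<close>

definition "thinning_loss s = s - thinning p s"

lemma thinning_loss_mono:
  assumes "0 \<le> s" "s \<le> t" "t \<le> 1"
  shows "thinning_loss s \<le> thinning_loss t"
  using thinning_contraction[of s t] assms by (cases "s = t") (auto simp: thinning_loss_def)

lemma thinning_loss_nonneg: "0 \<le> s \<Longrightarrow> s \<le> 1 \<Longrightarrow> 0 \<le> thinning_loss s"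
  using thinning_loss_mono[of 0 s] by (simp add: thinning_loss_def thinning_0)

lemma expectation_thinning:
  assumes "\<And>k. 0 \<le> v k" "\<And>k. v k \<le> 1"
  shows "measure_pmf.expectation a (\<lambda>j. thinning p (v (f j)))
    = measure_pmf.expectation a (\<lambda>j. v (f j)) - measure_pmf.expectation a (\<lambda>j. thinning_loss (v (f j)))"
    and "integrable (measure_pmf a) (\<lambda>j. v (f j))"
    and "integrable (measure_pmf a) (\<lambda>j. thinning_loss (v (f j)))"
proof -
  show 1: "integrable (measure_pmf a) (\<lambda>j. v (f j))"
    using assms by (intro integrable_pmf_bounded[where b = 1]) auto
  show 2: "integrable (measure_pmf a) (\<lambda>j. thinning_loss (v (f j)))"
    unfolding thinning_loss_def using integrable_thinning_comp[OF assms, of a p f] 1 by auto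
  show "measure_pmf.expectation a (\<lambda>j. thinning p (v (f j)))
    = measure_pmf.expectation a (\<lambda>j. v (f j)) - measure_pmf.expectation a (\<lambda>j. thinning_loss (v (f j)))"
    unfolding thinning_loss_def using integrable_thinning_comp[OF assms, of a p f] 1 by simp
qed

text \<open>The mean of the barrier is bounded above by its Taylor polynomial plus the probability
  of a jump beyond \<open>y / 2\<close>. The loss is bounded below by its value at \<open>s\<close>,
  the barrier at distance \<open>y + sqrt y\<close>, times Chebyshev's lower bound
  \<open>1 - \<eta>2 / y\<close> for the probability of landing no farther out.\<close>

lemma barrier_supersolution_bound:
  fixes S k :: int and y :: real
  assumes c: "0 < c" "c \<le> (real_of_int S)\<^sup>2" and "0 < S" "S < k" "\<eta>2 \<le> y"
    and y: "y = real_of_int k"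
  defines "s \<equiv> c / (y + sqrt y)\<^sup>2"
  shows "measure_pmf.expectation a (\<lambda>j. thinning p (barrier c S (k - j)))
    \<le> c / y\<^sup>2 * (1 + 3 * \<eta>2 / y\<^sup>2 + 4 * \<mu>3 / y ^ 3 + 12 * \<mu>4 / y ^ 4) + tail y
      - (1 - \<eta>2 / y) * (\<sigma>2 / 2 * s\<^sup>2 - \<tau> * s ^ 3)"
proof -
  have "0 < y" using assms by linarith
  note bounds = barrier_bounds[OF less_imp_le[OF c(1)] \<open>0 < S\<close> c(2)]
  let ?f = "\<lambda>j::int. 1 + 2 * (j / y) + 3 * (j / y)\<^sup>2 + 4 * (j / y) ^ 3 + 12 * (j / y) ^ 4"
  let ?I = "\<lambda>j. indicator {j. real_of_int j > y / 2} j :: real"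
  have int_I: "integrable (measure_pmf a) ?I"
    by (rule integrable_pmf_bounded[where b = 1]) (simp add: indicator_def)
  have int_f: "integrable (measure_pmf a) (\<lambda>j. c / y\<^sup>2 * ?f j)"
    by (intro integrable_mult_right quartic_expectation(1))
  \<comment> \<open>A jump beyond \<open>y / 2\<close> may reach the region where the barrier is 1,
    which the indicator pays for; for all other jumps \<open>j / y \<le> 1 / 2\<close> and the
    Taylor bound applies.\<close>
  have "barrier c S (k - j) \<le> c / y\<^sup>2 * ?f j + ?I j" for j
  proof (cases "real_of_int j > y / 2")
    case True
    then have "?I j = 1" by simp
    moreover have "0 \<le> c / y\<^sup>2 * ?f j"
      using True \<open>0 < y\<close> c by (intro mult_nonneg_nonneg) auto
    ultimately show ?thesis using bounds(2)[of "k - j"] by linarith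
  next
    case False
    then have "j < k" using \<open>0 < y\<close> y by linarith
    have "barrier c S (k - j) \<le> c / (real_of_int (k - j))\<^sup>2"
      using \<open>j < k\<close> c by (auto simp: barrier_def inv_square_def intro!: divide_left_mono power_mono)
    also have "\<dots> = c / y\<^sup>2 * (1 / (1 - j / y)\<^sup>2)"
      using \<open>0 < y\<close> \<open>j < k\<close> y by (simp add: field_simps)
    also have "\<dots> \<le> c / y\<^sup>2 * ?f j"
      using inverse_square_upper[of "j / y"] False \<open>0 < y\<close> c
      by (intro mult_left_mono) (auto simp: field_simps)
    finally show ?thesis using False by simp
  qed
  then have "measure_pmf.expectation a (\<lambda>j. barrier c S (k - j))
      \<le> measure_pmf.expectation a (\<lambda>j. c / y\<^sup>2 * ?f j + ?I j)"
    by (intro integral_mono expectation_thinning(2)[OF bounds(1,2), of "\<lambda>j. k - j"]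
        Bochner_Integration.integrable_add[OF int_f int_I])
  also have "\<dots> = measure_pmf.expectation a (\<lambda>j. c / y\<^sup>2 * ?f j) + measure_pmf.expectation a ?I"
    by (rule Bochner_Integration.integral_add[OF int_f int_I])
  also have "\<dots> = c / y\<^sup>2 * (1 + 3 * \<eta>2 / y\<^sup>2 + 4 * \<mu>3 / y ^ 3 + 12 * \<mu>4 / y ^ 4) + tail y"
    unfolding tail_eq by (subst integral_mult_right_zero) (simp only: quartic_expectation(2))
  finally have upper: "measure_pmf.expectation a (\<lambda>j. barrier c S (k - j))
      \<le> c / y\<^sup>2 * (1 + 3 * \<eta>2 / y\<^sup>2 + 4 * \<mu>3 / y ^ 3 + 12 * \<mu>4 / y ^ 4) + tail y" .

  define \<rho> where "\<rho> = thinning_loss s"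
  have "0 \<le> sqrt y" using \<open>0 < y\<close> by simp
  then have "real_of_int S \<le> y + sqrt y" using \<open>S < k\<close> y by linarith
  have "c \<le> (y + sqrt y)\<^sup>2"
  proof -
    have "(real_of_int S)\<^sup>2 \<le> (y + sqrt y)\<^sup>2"
      using \<open>0 < S\<close> \<open>real_of_int S \<le> y + sqrt y\<close> by (intro power_mono) auto
    then show ?thesis using c by simp
  qed
  moreover have "0 < (y + sqrt y)\<^sup>2" using \<open>0 < y\<close> by (intro zero_less_power add_pos_pos) auto
  ultimately have s: "0 \<le> s" "s \<le> 1" using c by (auto simp: s_def)
  have "0 \<le> \<rho>" using thinning_loss_nonneg[OF s] by (simp add: \<rho>_def)
  \<comment> \<open>Chebyshev's inequality in integrated form: \<open>1 - j\<^sup>2 / y\<close> is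
    at most the indicator of \<open>j \<ge> - sqrt y\<close>.\<close>
  have "\<rho> * (1 - (real_of_int j)\<^sup>2 / y) \<le> thinning_loss (barrier c S (k - j))" for j
  proof (cases "- sqrt y \<le> j")
    case True
    have "real_of_int (max (k - j) S) \<le> y + sqrt y"
      using True \<open>real_of_int S \<le> y + sqrt y\<close> y by (simp add: max_def)
    then have "s \<le> inv_square c S (k - j)"
      unfolding s_def inv_square_def using c \<open>0 < S\<close>
      by (intro divide_left_mono power_mono mult_pos_pos zero_less_power) auto
    also have "\<dots> \<le> barrier c S (k - j)" by (rule bounds)
    finally have "\<rho> \<le> thinning_loss (barrier c S (k - j))"
      unfolding \<rho>_def using s bounds by (intro thinning_loss_mono) auto
    moreover have "\<rho> * (1 - (real_of_int j)\<^sup>2 / y) \<le> \<rho> * 1"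
      using \<open>0 \<le> \<rho>\<close> \<open>0 < y\<close> by (intro mult_left_mono) auto
    ultimately show ?thesis by linarith
  next
    case False
    then have "(sqrt y)\<^sup>2 \<le> (- real_of_int j)\<^sup>2" using \<open>0 < y\<close> by (intro power_mono) auto
    then have "1 - (real_of_int j)\<^sup>2 / y \<le> 0" using \<open>0 < y\<close> by simp
    then have "\<rho> * (1 - (real_of_int j)\<^sup>2 / y) \<le> 0" using \<open>0 \<le> \<rho>\<close> by (rule mult_nonneg_nonpos[rotated])
    then show ?thesis using thinning_loss_nonneg[of "barrier c S (k - j)"] bounds[of "k - j"] by linarith
  qed
  then have "measure_pmf.expectation a (\<lambda>j. \<rho> * (1 - (real_of_int j)\<^sup>2 / y))
      \<le> measure_pmf.expectation a (\<lambda>j. thinning_loss (barrier c S (k - j)))"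
    using expectation_thinning(3)[OF bounds(1,2), of "\<lambda>j. k - j"] integrable_step[of 2]
    by (intro integral_mono) auto
  moreover have "measure_pmf.expectation a (\<lambda>j. \<rho> * (1 - (real_of_int j)\<^sup>2 / y)) = (1 - \<eta>2 / y) * \<rho>"
    using integrable_step[of 2] by (simp add: step_second_moment)
  moreover have "(1 - \<eta>2 / y) * (\<sigma>2 / 2 * s\<^sup>2 - \<tau> * s ^ 3) \<le> (1 - \<eta>2 / y) * \<rho>"
    using thinning_bounds(2)[OF s] assms \<open>0 < y\<close>
    by (intro mult_left_mono) (auto simp: \<rho>_def thinning_loss_def)
  ultimately show ?thesis
    unfolding expectation_thinning(1)[OF bounds(1,2), of "\<lambda>j. k - j"] using upper by linarith
qed

text \<open>Multiplied by \<open>y ^ 4\<close>, the bound on the excess over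
  \<open>c / y\<^sup>2\<close> tends to \<open>c * (3 * \<eta>2 - \<sigma>2 * c / 2)\<close>:
  diffusion against branching loss. This is negative exactly for positive \<open>c\<close> above the
  critical constant.\<close>

lemma barrier_supersolution:
  assumes "6 * \<eta>2 / \<sigma>2 < c"
  shows "\<exists>S0>0. \<forall>S y::int. S0 \<le> S \<longrightarrow> S < y \<longrightarrow> c \<le> (real_of_int S)\<^sup>2 \<and>
    measure_pmf.expectation a (\<lambda>j. thinning p (barrier c S (y - j))) \<le> barrier c S y"
proof -
  have "0 < 6 * \<eta>2 / \<sigma>2" using \<eta>2_pos \<sigma>2_pos by simp
  then have c: "0 < c" using assms by linarith
  have "6 * \<eta>2 < \<sigma>2 * c" using assms \<sigma>2_pos by (simp add: field_simps)
  then have neg: "3 * c * \<eta>2 - \<sigma>2 / 2 * c\<^sup>2 + 0 < 0"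
    using c mult_strict_left_mono[of "6 * \<eta>2" "\<sigma>2 * c" "c"] by (simp add: power2_eq_square algebra_simps)
  define F where "F = (\<lambda>y::real. c / y\<^sup>2 * (3 * \<eta>2 / y\<^sup>2 + 4 * \<mu>3 / y ^ 3 + 12 * \<mu>4 / y ^ 4)
      - (1 - \<eta>2 / y) * (\<sigma>2 / 2 * (c / (y + sqrt y)\<^sup>2)\<^sup>2 - \<tau> * (c / (y + sqrt y)\<^sup>2) ^ 3))"
  have inv: "((\<lambda>y::real. 1 / y) \<longlongrightarrow> 0) at_top" by real_asymp
  have rescaled: "((\<lambda>y::real. y\<^sup>2 * (c / (y + sqrt y)\<^sup>2)) \<longlongrightarrow> c) at_top" by real_asymp
  have "((\<lambda>y. c * (3 * \<eta>2 + 4 * \<mu>3 * (1 / y) + 12 * \<mu>4 * (1 / y)\<^sup>2)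
      - (1 - \<eta>2 * (1 / y)) * (\<sigma>2 / 2 * (y\<^sup>2 * (c / (y + sqrt y)\<^sup>2))\<^sup>2
        - \<tau> * (y\<^sup>2 * (c / (y + sqrt y)\<^sup>2)) ^ 3 * (1 / y)\<^sup>2))
      \<longlongrightarrow> c * (3 * \<eta>2 + 4 * \<mu>3 * 0 + 12 * \<mu>4 * 0\<^sup>2)
      - (1 - \<eta>2 * 0) * (\<sigma>2 / 2 * c\<^sup>2 - \<tau> * c ^ 3 * 0\<^sup>2)) at_top"
    by (intro tendsto_intros inv rescaled)
  moreover have "eventually (\<lambda>y. c * (3 * \<eta>2 + 4 * \<mu>3 * (1 / y) + 12 * \<mu>4 * (1 / y)\<^sup>2)
      - (1 - \<eta>2 * (1 / y)) * (\<sigma>2 / 2 * (y\<^sup>2 * (c / (y + sqrt y)\<^sup>2))\<^sup>2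
        - \<tau> * (y\<^sup>2 * (c / (y + sqrt y)\<^sup>2)) ^ 3 * (1 / y)\<^sup>2) = y ^ 4 * F y) at_top"
    using eventually_gt_at_top[of 0]
  proof eventually_elim
    case (elim y)
    then have "y \<noteq> 0" by simp
    have *: "y ^ 4 * (A - B * C) = y ^ 4 * A - B * (y ^ 4 * C)" for A B C :: real
      by (simp add: algebra_simps)
    show ?case
      unfolding F_def
      by (subst *) (simp only: rescale_quartic[OF \<open>y \<noteq> 0\<close>] rescale_square[OF \<open>y \<noteq> 0\<close>]
        times_divide_eq_right mult_1_right)
  qed
  ultimately have "((\<lambda>y. y ^ 4 * F y) \<longlongrightarrow> 3 * c * \<eta>2 - \<sigma>2 / 2 * c\<^sup>2) at_top"
    by (rule Lim_transform_eventually[THEN tendsto_eq_rhs]) simp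
  from tendsto_add[OF this tail_tendsto]
  have "((\<lambda>y. y ^ 4 * F y + y ^ 4 * tail y) \<longlongrightarrow> 3 * c * \<eta>2 - \<sigma>2 / 2 * c\<^sup>2 + 0) at_top" .
  from order_tendstoD(2)[OF this neg]
  have "eventually (\<lambda>y. F y + tail y \<le> 0) at_top"
    using eventually_gt_at_top[of 0]
  proof eventually_elim
    case (elim y)
    then have "y ^ 4 * (F y + tail y) < 0" by (simp only: distrib_left)
    then show ?case using elim(2) by (simp add: mult_less_0_iff)
  qed
  then obtain y0 where y0: "F y + tail y \<le> 0" if "y \<ge> y0" for y
    by (auto simp: eventually_at_top_linorder)
  \<comment> \<open>\<open>y0\<close> makes the excess nonpositive, \<open>c\<close> and 1 give
    \<open>c \<le> S\<^sup>2\<close>, and \<open>\<eta>2\<close> keeps the factor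
    \<open>1 - \<eta>2 / y\<close> nonnegative.\<close>
  define S0 where "S0 = \<lceil>max y0 (max c (max \<eta>2 1))\<rceil>"
  show ?thesis
  proof (intro exI[of _ S0] conjI allI impI)
    have "max y0 (max c (max \<eta>2 1)) \<le> S0" unfolding S0_def by (rule le_of_int_ceiling)
    then have S0: "y0 \<le> S0" "c \<le> S0" "\<eta>2 \<le> S0" "1 \<le> S0" by auto
    then show "S0 > 0" by linarith
    fix S y :: int
    assume *: "S0 \<le> S" "S < y"
    have S: "c \<le> S" "1 \<le> real_of_int S" "0 < S" using S0 * by linarith+
    show cS: "c \<le> (real_of_int S)\<^sup>2"
      using mult_mono[of 1 S c S] S c by (simp add: power2_eq_square)
    have y: "y0 \<le> y" "\<eta>2 \<le> y" "0 < y" using S0 * S by linarith+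
    have "measure_pmf.expectation a (\<lambda>j. thinning p (barrier c S (y - j))) \<le> c / (real_of_int y)\<^sup>2 + (F y + tail y)"
      using barrier_supersolution_bound[OF c cS S(3) *(2) y(2) refl]
      by (simp only: F_def distrib_left[of _ 1] add.assoc mult_1_right)
    also have "\<dots> \<le> c / (real_of_int y)\<^sup>2" using y0[OF y(1)] by simp
    also have "\<dots> = barrier c S y" using * y by (simp add: barrier_def inv_square_def)
    finally show "measure_pmf.expectation a (\<lambda>j. thinning p (barrier c S (y - j))) \<le> barrier c S y" .
  qed
qed

text \<open>Now the mean is bounded below by a Taylor minorant and the loss above by
  \<open>\<sigma>2 / 2\<close> times the mean square. The square is estimated by its expansion for
  jumps up to \<open>y / 2\<close> and by 1 for larger ones.\<close>

lemma inv_square_subsolution_bound: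
  fixes S k :: int and y :: real
  assumes c: "0 < c" "c \<le> (real_of_int S)\<^sup>2" and "0 < S" "2 * S \<le> k"
    and y: "y = real_of_int k"
  shows "c / y\<^sup>2 * (1 + 3 * \<eta>2 / y\<^sup>2 + 4 * \<mu>3 / y ^ 3 - 52 * \<mu>4 / y ^ 4)
      - \<sigma>2 / 2 * (c\<^sup>2 / y ^ 4 * (1 + 20 * \<eta>2 / y\<^sup>2 + 32 * \<mu>3 / y ^ 3 + 64 * \<mu>4 / y ^ 4) + tail y)
    \<le> measure_pmf.expectation a (\<lambda>j. thinning p (inv_square c S (k - j)))"
proof -
  have "0 < y" using assms by linarith
  have bounds: "0 \<le> inv_square c S z" "inv_square c S z \<le> 1" for z
    using inv_square_nonneg[of c S z] inv_square_le_1[of c S z] assms by auto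
  have near: "inv_square c S (k - j) = c / y\<^sup>2 * (1 / (1 - j / y)\<^sup>2)" if "\<not> real_of_int j > y / 2" for j
  proof -
    have "S \<le> k - j" "j < k" using that \<open>2 * S \<le> k\<close> \<open>0 < S\<close> y by linarith+
    then show ?thesis using \<open>0 < y\<close> y by (simp add: inv_square_def field_simps)
  qed
  \<comment> \<open>The term \<open>- 52 * (j / y) ^ 4\<close> makes the polynomial nonpositive for
    large jumps and only lowers it for the others, so it is a minorant for every
    \<open>j\<close>.\<close>
  let ?f = "\<lambda>j::int. 1 + 2 * (j / y) + 3 * (j / y)\<^sup>2 + 4 * (j / y) ^ 3 + (- 52) * (j / y) ^ 4"
  have "c / y\<^sup>2 * ?f j \<le> inv_square c S (k - j)" for j
  proof (cases "real_of_int j > y / 2")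
    case True
    then have "?f j \<le> 0" using cubic_le_quartic[of "j / y"] \<open>0 < y\<close> by (simp add: field_simps)
    then have "c / y\<^sup>2 * ?f j \<le> 0" using c by (intro mult_nonneg_nonpos) auto
    then show ?thesis using bounds(1)[of "k - j"] by linarith
  next
    case False
    then have "j / y \<le> 1 / 2" using \<open>0 < y\<close> by (simp add: field_simps)
    moreover have "0 \<le> (j / y) ^ 4" by simp
    ultimately have "?f j \<le> 1 / (1 - j / y)\<^sup>2"
      using inverse_square_lower[of "j / y"] by linarith
    then show ?thesis unfolding near[OF False] using c by (intro mult_left_mono) auto
  qed
  then have "measure_pmf.expectation a (\<lambda>j. c / y\<^sup>2 * ?f j)
      \<le> measure_pmf.expectation a (\<lambda>j. inv_square c S (k - j))"
    by (intro integral_mono expectation_thinning(2)[OF bounds, of "\<lambda>j. k - j"]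
        integrable_mult_right quartic_expectation(1))
  moreover have "measure_pmf.expectation a (\<lambda>j. c / y\<^sup>2 * ?f j)
      = c / y\<^sup>2 * (1 + 3 * \<eta>2 / y\<^sup>2 + 4 * \<mu>3 / y ^ 3 - 52 * \<mu>4 / y ^ 4)"
    by (subst integral_mult_right_zero, subst quartic_expectation(2)) simp
  ultimately have lower: "c / y\<^sup>2 * (1 + 3 * \<eta>2 / y\<^sup>2 + 4 * \<mu>3 / y ^ 3 - 52 * \<mu>4 / y ^ 4)
      \<le> measure_pmf.expectation a (\<lambda>j. inv_square c S (k - j))" by (simp only:)

  \<comment> \<open>The expanded square of the quadratic majorant
    \<open>1 + 2 * t + 8 * t\<^sup>2\<close>.\<close>
  let ?g = "\<lambda>j::int. 1 + 4 * (j / y) + 20 * (j / y)\<^sup>2 + 32 * (j / y) ^ 3 + 64 * (j / y) ^ 4"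
  let ?I = "\<lambda>j. indicator {j. real_of_int j > y / 2} j :: real"
  have g: "1 + 4 * t + 20 * t\<^sup>2 + 32 * t ^ 3 + 64 * t ^ 4 = (1 + 2 * t + 8 * t\<^sup>2)\<^sup>2" for t :: real
    by (simp add: power2_eq_square power3_eq_cube power4_eq_xxxx algebra_simps)
  have "thinning_loss (inv_square c S (k - j)) \<le> \<sigma>2 / 2 * (c\<^sup>2 / y ^ 4 * ?g j + ?I j)" for j
  proof -
    let ?G = "inv_square c S (k - j)"
    have "?G\<^sup>2 \<le> c\<^sup>2 / y ^ 4 * ?g j + ?I j"
    proof (cases "real_of_int j > y / 2")
      case True
      have "?G\<^sup>2 \<le> 1" using bounds by (simp add: power_le_one)
      moreover have "0 \<le> c\<^sup>2 / y ^ 4 * ?g j" unfolding g by simp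
      ultimately show ?thesis using True by simp
    next
      case False
      then have "j / y \<le> 1 / 2" using \<open>0 < y\<close> by (simp add: field_simps)
      then have "?G \<le> c / y\<^sup>2 * (1 + 2 * (j / y) + 8 * (j / y)\<^sup>2)"
        unfolding near[OF False] using c by (intro mult_left_mono inverse_square_upper_quadratic) auto
      then have "?G\<^sup>2 \<le> (c / y\<^sup>2 * (1 + 2 * (j / y) + 8 * (j / y)\<^sup>2))\<^sup>2"
        using bounds by (intro power_mono) auto
      also have "\<dots> = c\<^sup>2 / y ^ 4 * ?g j"
        unfolding g power_mult_distrib[of "c / y\<^sup>2"] power_divide[of c] by simp
      finally show ?thesis using False by simp
    qed
    then have "\<sigma>2 / 2 * ?G\<^sup>2 \<le> \<sigma>2 / 2 * (c\<^sup>2 / y ^ 4 * ?g j + ?I j)"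
      using \<sigma>2_pos by (intro mult_left_mono) auto
    then show ?thesis
      using thinning_bounds(1)[OF bounds, of "k - j"] unfolding thinning_loss_def by linarith
  qed
  moreover have int_g: "integrable (measure_pmf a) (\<lambda>j. c\<^sup>2 / y ^ 4 * ?g j)"
    by (intro integrable_mult_right quartic_expectation(1))
  moreover have int_I: "integrable (measure_pmf a) ?I"
    by (rule integrable_pmf_bounded[where b = 1]) (simp add: indicator_def)
  ultimately have "measure_pmf.expectation a (\<lambda>j. thinning_loss (inv_square c S (k - j)))
      \<le> measure_pmf.expectation a (\<lambda>j. \<sigma>2 / 2 * (c\<^sup>2 / y ^ 4 * ?g j + ?I j))"
    by (intro integral_mono expectation_thinning(3)[OF bounds, of "\<lambda>j. k - j"]
        integrable_mult_right Bochner_Integration.integrable_add[OF int_g int_I])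
  also have "\<dots> = \<sigma>2 / 2 * (measure_pmf.expectation a (\<lambda>j. c\<^sup>2 / y ^ 4 * ?g j) + measure_pmf.expectation a ?I)"
    by (subst integral_mult_right_zero) (simp only: Bochner_Integration.integral_add[OF int_g int_I])
  also have "measure_pmf.expectation a (\<lambda>j. c\<^sup>2 / y ^ 4 * ?g j)
      = c\<^sup>2 / y ^ 4 * (1 + 20 * \<eta>2 / y\<^sup>2 + 32 * \<mu>3 / y ^ 3 + 64 * \<mu>4 / y ^ 4)"
    by (subst integral_mult_right_zero) (simp only: quartic_expectation(2))
  finally show ?thesis
    unfolding expectation_thinning(1)[OF bounds, of "\<lambda>j. k - j"] tail_eq[symmetric] using lower by linarith
qed

text \<open>The same limit \<open>c * (3 * \<eta>2 - \<sigma>2 * c / 2)\<close> at scale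
  \<open>y ^ -4\<close>, now positive because \<open>c\<close> lies below the critical
  constant.\<close>

lemma inv_square_subsolution:
  assumes "0 < c" "c < 6 * \<eta>2 / \<sigma>2"
  shows "\<exists>S>0. c \<le> (real_of_int S)\<^sup>2 \<and> (\<forall>y\<ge>2 * S. inv_square c S y
    \<le> measure_pmf.expectation a (\<lambda>j. thinning p (inv_square c S (y - j))))"
proof -
  have "\<sigma>2 * c < 6 * \<eta>2" using assms \<sigma>2_pos by (simp add: field_simps)
  then have pos: "0 < 3 * c * \<eta>2 - \<sigma>2 / 2 * c\<^sup>2 - \<sigma>2 / 2 * 0"
    using assms mult_strict_left_mono[of "\<sigma>2 * c" "6 * \<eta>2" "c"] by (simp add: power2_eq_square algebra_simps)
  define F where "F = (\<lambda>y::real. c / y\<^sup>2 * (3 * \<eta>2 / y\<^sup>2 + 4 * \<mu>3 / y ^ 3 - 52 * \<mu>4 / y ^ 4)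
      - \<sigma>2 / 2 * (c\<^sup>2 / y ^ 4 * (1 + 20 * \<eta>2 / y\<^sup>2 + 32 * \<mu>3 / y ^ 3 + 64 * \<mu>4 / y ^ 4)))"
  have inv: "((\<lambda>y::real. 1 / y) \<longlongrightarrow> 0) at_top" by real_asymp
  have "((\<lambda>y. c * (3 * \<eta>2 + 4 * \<mu>3 * (1 / y) - 52 * \<mu>4 * (1 / y)\<^sup>2)
      - \<sigma>2 / 2 * (c\<^sup>2 * (1 + 20 * \<eta>2 * (1 / y)\<^sup>2 + 32 * \<mu>3 * (1 / y) ^ 3 + 64 * \<mu>4 * (1 / y) ^ 4)))
      \<longlongrightarrow> c * (3 * \<eta>2 + 4 * \<mu>3 * 0 - 52 * \<mu>4 * 0\<^sup>2)
      - \<sigma>2 / 2 * (c\<^sup>2 * (1 + 20 * \<eta>2 * 0\<^sup>2 + 32 * \<mu>3 * 0 ^ 3 + 64 * \<mu>4 * 0 ^ 4))) at_top"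
    by (intro tendsto_intros inv)
  moreover have "eventually (\<lambda>y. c * (3 * \<eta>2 + 4 * \<mu>3 * (1 / y) - 52 * \<mu>4 * (1 / y)\<^sup>2)
      - \<sigma>2 / 2 * (c\<^sup>2 * (1 + 20 * \<eta>2 * (1 / y)\<^sup>2 + 32 * \<mu>3 * (1 / y) ^ 3 + 64 * \<mu>4 * (1 / y) ^ 4))
      = y ^ 4 * F y) at_top"
    using eventually_gt_at_top[of 0]
  proof eventually_elim
    case (elim y)
    then have "y \<noteq> 0" by simp
    have *: "y ^ 4 * (A - B * (C / y ^ 4 * D)) = y ^ 4 * A - B * (C * D)" for A B C D :: real
      using \<open>y \<noteq> 0\<close> by (simp add: right_diff_distrib)
    show ?case
      using rescale_quartic[OF \<open>y \<noteq> 0\<close>, of c "3 * \<eta>2" "4 * \<mu>3" "- 52 * \<mu>4"]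
      unfolding F_def * by (simp add: power_divide)
  qed
  ultimately have "((\<lambda>y. y ^ 4 * F y) \<longlongrightarrow> 3 * c * \<eta>2 - \<sigma>2 / 2 * c\<^sup>2) at_top"
    by (rule Lim_transform_eventually[THEN tendsto_eq_rhs]) simp
  from tendsto_diff[OF this tendsto_mult[OF tendsto_const tail_tendsto]]
  have "((\<lambda>y. y ^ 4 * F y - \<sigma>2 / 2 * (y ^ 4 * tail y)) \<longlongrightarrow> 3 * c * \<eta>2 - \<sigma>2 / 2 * c\<^sup>2 - \<sigma>2 / 2 * 0) at_top" .
  from order_tendstoD(1)[OF this pos]
  have "eventually (\<lambda>y. 0 \<le> F y - \<sigma>2 / 2 * tail y) at_top"
    using eventually_gt_at_top[of 0]
  proof eventually_elim
    case (elim y)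
    then have "0 < y ^ 4 * (F y - \<sigma>2 / 2 * tail y)"
      by (simp only: right_diff_distrib mult.left_commute)
    then show ?case using elim(2) by (simp add: zero_less_mult_iff)
  qed
  then obtain y0 where y0: "0 \<le> F y - \<sigma>2 / 2 * tail y" if "y \<ge> y0" for y
    by (auto simp: eventually_at_top_linorder)
  define S where "S = \<lceil>max y0 (max c 1)\<rceil>"
  have "max y0 (max c 1) \<le> S" unfolding S_def by (rule le_of_int_ceiling)
  then have S: "y0 \<le> S" "c \<le> S" "1 \<le> real_of_int S" "0 < S" by auto
  have cS: "c \<le> (real_of_int S)\<^sup>2"
    using mult_mono[of 1 S c S] S assms by (simp add: power2_eq_square)
  show ?thesis
  proof (intro exI[of _ S] conjI allI impI)
    fix y assume y: "2 * S \<le> y"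
    then have "y0 \<le> y" "0 < y" "S \<le> y" using S by linarith+
    have "inv_square c S y = c / (real_of_int y)\<^sup>2" using \<open>S \<le> y\<close> by (simp add: inv_square_def)
    also have "\<dots> \<le> c / (real_of_int y)\<^sup>2 + (F y - \<sigma>2 / 2 * tail y)" using y0[OF \<open>y0 \<le> y\<close>] by simp
    also have "\<dots> \<le> measure_pmf.expectation a (\<lambda>j. thinning p (inv_square c S (y - j)))"
      using inv_square_subsolution_bound[OF assms(1) cS S(4) y refl]
      by (simp only: F_def distrib_left[of _ 1] distrib_left[of "\<sigma>2 / 2"] add.assoc add_diff_eq[symmetric] mult_1_right)
    finally show "inv_square c S y \<le> measure_pmf.expectation a (\<lambda>j. thinning p (inv_square c S (y - j)))" .
  qed (use S cS in auto)
qed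

end

section \<open>Tail asymptotics\<close>

lemma filterlim_real_of_int_compose:
  assumes "filterlim f F at_top"
  shows "filterlim (\<lambda>k::int. f (real_of_int k)) F at_top"
  by (rule filterlim_compose[OF assms filterlim_real_of_int_at_top])

context critical_laws
begin

text \<open>Monotonicity and contraction make \<open>thinning p\<close> Lipschitz with constant
  1.\<close>

lemma thinning_tendsto:
  assumes "(f \<longlongrightarrow> q) F" "0 \<le> q" "q \<le> 1" "\<And>n. 0 \<le> f n" "\<And>n. f n \<le> 1"
  shows "((\<lambda>n. thinning p (f n)) \<longlongrightarrow> thinning p q) F"
proof (rule LIM_zero_cancel, rule Lim_null_comparison)
  have le: "\<bar>thinning p s - thinning p t\<bar> \<le> \<bar>s - t\<bar>" if "0 \<le> s" "s \<le> 1" "0 \<le> t" "t \<le> 1" for s t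
    using thinning_contraction[of s t] thinning_contraction[of t s]
      thinning_mono[of s t p] thinning_mono[of t s p] that
    by (cases s t rule: linorder_cases) simp_all
  show "eventually (\<lambda>n. norm (thinning p (f n) - thinning p q) \<le> \<bar>f n - q\<bar>) F"
    by (intro always_eventually allI, unfold real_norm_def) (intro le assms)
  show "((\<lambda>n. \<bar>f n - q\<bar>) \<longlongrightarrow> 0) F"
    using assms(1) by (intro tendsto_rabs_zero LIM_zero)
qed

context
  fixes u :: "int \<Rightarrow> real"
  assumes u_bounds: "\<And>k. 0 \<le> u k" "\<And>k. u k \<le> 1"
    and u_antimono: "antimono u"
    and u_nonpos: "\<And>k. k \<le> 0 \<Longrightarrow> u k = 1"
    and u_recursion: "\<And>k. k > 0 \<Longrightarrow> u k = measure_pmf.expectation a (\<lambda>j. thinning p (u (k - j)))"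
begin

text \<open>A decreasing bounded function has a limit \<open>q\<close>. Dominated convergence in the
  recursion gives \<open>thinning p q = q\<close>, and strict contraction against the fixed point 0
  leaves only \<open>q = 0\<close>.\<close>

lemma solution_tendsto_0: "(u \<longlongrightarrow> 0) at_top"
proof -
  define q where "q = (INF k. u k)"
  have bdd: "bdd_below (range u)" using u_bounds(1) by (intro bdd_belowI[where m = 0]) auto
  have lim: "(u \<longlongrightarrow> q) at_top"
  proof (rule order_tendstoI)
    fix x assume "x < q"
    then show "eventually (\<lambda>k. x < u k) at_top"
      using cINF_lower[OF bdd] unfolding q_def by (intro always_eventually allI) (blast intro: less_le_trans)
  next
    fix x assume "q < x"
    then obtain l where "u l < x" using cINF_less_iff[OF _ bdd] unfolding q_def by auto
    then have "u k < x" if "l \<le> k" for k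
      using antimonoD[OF u_antimono that] by linarith
    then show "eventually (\<lambda>k. u k < x) at_top"
      by (auto simp: eventually_at_top_linorder)
  qed
  have q: "0 \<le> q" "q \<le> u k" for k
    using u_bounds cINF_lower[OF bdd] unfolding q_def by (auto intro: cINF_greatest)
  then have "q \<le> 1" using u_bounds(2) order_trans by blast
  have nat_lim: "(\<lambda>n. u (int n - j)) \<longlonglongrightarrow> q" for j
  proof (rule filterlim_compose[OF lim])
    show "filterlim (\<lambda>n. int n - j) at_top sequentially"
      unfolding filterlim_at_top
    proof (rule allI)
      fix Z show "eventually (\<lambda>n. Z \<le> int n - j) sequentially"
        using eventually_ge_at_top[of "nat (Z + j)"] by eventually_elim auto
    qed
  qed
  have "(\<lambda>n. thinning p (u (int n - j))) \<longlonglongrightarrow> thinning p q" for j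
    by (rule thinning_tendsto[OF nat_lim q(1) \<open>q \<le> 1\<close>]) (rule u_bounds)+
  then have "(\<lambda>n. measure_pmf.expectation a (\<lambda>j. thinning p (u (int n - j))))
      \<longlonglongrightarrow> measure_pmf.expectation a (\<lambda>j. thinning p q)"
    by (intro integral_dominated_convergence[where w = "\<lambda>_. 1"] AE_pmfI)
      (simp_all add: abs_thinning_le_1 u_bounds)
  moreover have "eventually (\<lambda>n. measure_pmf.expectation a (\<lambda>j. thinning p (u (int n - j))) = u (int n)) sequentially"
    using eventually_gt_at_top[of 0] by eventually_elim (rule u_recursion[symmetric], simp)
  ultimately have "(\<lambda>n. u (int n)) \<longlonglongrightarrow> thinning p q"
    by (simp add: tendsto_cong)
  moreover have "(\<lambda>n. u (int n)) \<longlonglongrightarrow> q" using nat_lim[of 0] by simp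
  ultimately have "thinning p q = q" by (rule LIMSEQ_unique)
  then have "q = 0"
    using thinning_contraction[of 0 q] q(1) \<open>q \<le> 1\<close> by (cases "q = 0") (auto simp: thinning_0)
  with lim show ?thesis by simp
qed

text \<open>The barrier is moved right to a place beyond which \<open>u\<close> is already below the
  plateau value \<open>c / S\<^sup>2\<close>; it then dominates \<open>u\<close> up to the end of
  the plateau, and comparison carries this on.\<close>

lemma solution_upper_bound:
  assumes "6 * \<eta>2 / \<sigma>2 < c"
  shows "\<exists>B K. \<forall>k>K. u k \<le> c / (real_of_int (k - B))\<^sup>2"
proof -
  have "0 < 6 * \<eta>2 / \<sigma>2" using \<eta>2_pos \<sigma>2_pos by simp
  then have c: "0 < c" using assms by linarith
  obtain S :: int where S: "0 < S" and super: "\<And>y. S < y \<Longrightarrow> c \<le> (real_of_int S)\<^sup>2 \<and>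
    measure_pmf.expectation a (\<lambda>j. thinning p (barrier c S (y - j))) \<le> barrier c S y"
    using barrier_supersolution[OF assms] by blast
  have cS: "c \<le> (real_of_int S)\<^sup>2" using super[of "S + 1"] by simp
  note bounds = barrier_bounds[OF less_imp_le[OF c] S cS]
  have "0 < c / (real_of_int S)\<^sup>2" using c S by simp
  then obtain B where B: "u k < c / (real_of_int S)\<^sup>2" if "k \<ge> B" for k
    using order_tendstoD(2)[OF solution_tendsto_0, of "c / (real_of_int S)\<^sup>2"]
    by (auto simp: eventually_at_top_linorder)
  \<comment> \<open>The shift \<open>max B 0\<close> is nonnegative, so the recursion for
    \<open>u\<close> is available at every point beyond the plateau.\<close>
  have "u k \<le> barrier c S (k - max B 0)" for k
  proof (rule comparison_principle[where K = "max B 0 + S" and v = u and u = "\<lambda>k. barrier c S (k - max B 0)"])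
    show "0 \<le> u k" "u k \<le> 1" for k by (rule u_bounds)+
    show "0 \<le> barrier c S (k - max B 0)" "barrier c S (k - max B 0) \<le> 1" for k by (rule bounds)+
    show "(u \<longlongrightarrow> 0) at_top" by (rule solution_tendsto_0)
    show "u k \<le> barrier c S (k - max B 0)" if "k \<le> max B 0 + S" for k
    proof (cases "k \<le> max B 0")
      case True
      then show ?thesis using u_bounds by (simp add: barrier_def)
    next
      case False
      then show ?thesis using B[of k] that by (auto simp: barrier_def inv_square_def max_def split: if_splits)
    qed
    show "u k \<le> measure_pmf.expectation a (\<lambda>j. thinning p (u (k - j)))" if "max B 0 + S < k" for k
      using u_recursion[of k] that S by simp
    show "measure_pmf.expectation a (\<lambda>j. thinning p (barrier c S (k - j - max B 0))) \<le> barrier c S (k - max B 0)"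
      if "max B 0 + S < k" for k
      using super[of "k - max B 0"] that by (simp add: algebra_simps)
  qed
  then have "u k \<le> c / (real_of_int (k - max B 0))\<^sup>2" if "k > max B 0 + S" for k
    using that S by (smt (verit, best) barrier_def inv_square_def)
  then show ?thesis by blast
qed

text \<open>Shifting by \<open>2 * S\<close> to the left puts every \<open>k > 0\<close> into the
  range of the subsolution inequality; for \<open>k \<le> 0\<close> the value 1 of \<open>u\<close>
  dominates.\<close>

lemma solution_lower_bound:
  assumes "0 < c" "c < 6 * \<eta>2 / \<sigma>2"
  shows "\<exists>B. \<forall>k>0. c / (real_of_int (k + B))\<^sup>2 \<le> u k"
proof -
  obtain S where S: "0 < S" "c \<le> (real_of_int S)\<^sup>2" and sub: "\<And>y. 2 * S \<le> y \<Longrightarrow> inv_square c S y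
    \<le> measure_pmf.expectation a (\<lambda>j. thinning p (inv_square c S (y - j)))"
    using inv_square_subsolution[OF assms] by blast
  have bounds: "0 \<le> inv_square c S y" "inv_square c S y \<le> 1" for y
    using inv_square_nonneg inv_square_le_1 S assms by auto
  have "inv_square c S (k + 2 * S) \<le> u k" for k
  proof (rule comparison_principle[where K = 0 and u = u and v = "\<lambda>k. inv_square c S (k + 2 * S)"])
    show "0 \<le> u k" "u k \<le> 1" for k by (rule u_bounds)+
    show "0 \<le> inv_square c S (k + 2 * S)" "inv_square c S (k + 2 * S) \<le> 1" for k by (rule bounds)+
    show "((\<lambda>k. inv_square c S (k + 2 * S)) \<longlongrightarrow> 0) at_top"
      using inv_square_tendsto_0[of c S "- 2 * S"] by simp
    show "inv_square c S (k + 2 * S) \<le> u k" if "k \<le> 0" for k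
      using bounds u_nonpos[OF that] by simp
    show "measure_pmf.expectation a (\<lambda>j. thinning p (u (k - j))) \<le> u k" if "0 < k" for k
      using u_recursion[OF that] by simp
    show "inv_square c S (k + 2 * S)
        \<le> measure_pmf.expectation a (\<lambda>j. thinning p (inv_square c S (k - j + 2 * S)))" if "0 < k" for k
      using sub[of "k + 2 * S"] that by (simp add: algebra_simps)
  qed
  then have "c / (real_of_int (k + 2 * S))\<^sup>2 \<le> u k" if "k > 0" for k
    using that S by (smt (verit, best) inv_square_def)
  then show ?thesis by blast
qed

text \<open>The shifts by \<open>B\<close> disappear after multiplication by
  \<open>k\<^sup>2\<close>, so the limit is enclosed by every \<open>c\<close> below and every
  \<open>c\<close> above the critical constant.\<close>

theorem solution_asymptotics: "((\<lambda>k. (real_of_int k)\<^sup>2 * u k) \<longlongrightarrow> 6 * \<eta>2 / \<sigma>2) at_top"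
proof (rule order_tendstoI)
  fix l assume l: "l < 6 * \<eta>2 / \<sigma>2"
  have "0 < 6 * \<eta>2 / \<sigma>2" using \<eta>2_pos \<sigma>2_pos by simp
  \<comment> \<open>The maximum with 0 makes \<open>c\<close> positive, as the subsolution
    requires.\<close>
  then obtain c where c: "max l 0 < c" "c < 6 * \<eta>2 / \<sigma>2"
    using dense[of "max l 0" "6 * \<eta>2 / \<sigma>2"] l by auto
  then obtain B where B: "c / (real_of_int (k + B))\<^sup>2 \<le> u k" if "k > 0" for k
    using solution_lower_bound[of c] by auto
  have "((\<lambda>k. k\<^sup>2 * (c / (k + real_of_int B)\<^sup>2)) \<longlongrightarrow> c) at_top" by real_asymp
  from order_tendstoD(1)[OF filterlim_real_of_int_compose[OF this], of l] c
  have "eventually (\<lambda>k. l < (real_of_int k)\<^sup>2 * (c / (real_of_int k + real_of_int B)\<^sup>2)) at_top" by simp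
  then show "eventually (\<lambda>k. l < (real_of_int k)\<^sup>2 * u k) at_top"
    using eventually_gt_at_top[of 0]
  proof eventually_elim
    case (elim k)
    have "(real_of_int k)\<^sup>2 * (c / (real_of_int k + real_of_int B)\<^sup>2) \<le> (real_of_int k)\<^sup>2 * u k"
      using B[OF elim(2)] by (intro mult_left_mono) auto
    then show ?case using elim(1) by linarith
  qed
next
  fix l assume l: "6 * \<eta>2 / \<sigma>2 < l"
  then obtain c where c: "6 * \<eta>2 / \<sigma>2 < c" "c < l" using dense by blast
  then obtain B K where B: "u k \<le> c / (real_of_int (k - B))\<^sup>2" if "k > K" for k
    using solution_upper_bound[of c] by auto
  have "((\<lambda>k. k\<^sup>2 * (c / (k - real_of_int B)\<^sup>2)) \<longlongrightarrow> c) at_top" by real_asymp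
  from order_tendstoD(2)[OF filterlim_real_of_int_compose[OF this], of l] c
  have "eventually (\<lambda>k. (real_of_int k)\<^sup>2 * (c / (real_of_int k - real_of_int B)\<^sup>2) < l) at_top" by simp
  then show "eventually (\<lambda>k. (real_of_int k)\<^sup>2 * u k < l) at_top"
    using eventually_gt_at_top[of K]
  proof eventually_elim
    case (elim k)
    have "(real_of_int k)\<^sup>2 * u k \<le> (real_of_int k)\<^sup>2 * (c / (real_of_int k - real_of_int B)\<^sup>2)"
      using B[OF elim(2)] by (intro mult_left_mono) auto
    then show ?case using elim(1) by linarith
  qed
qed

end

end

section \<open>Hitting events of the branching random walk\<close>

text \<open>\<open>k\<close> is the distance still to be covered, measured from the location of
  \<open>v\<close>, and \<open>m\<close> bounds the number of further generations. This form matches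
  conditioning on the first jump and offspring number.\<close>

primrec reaches :: "(label \<Rightarrow> int) \<Rightarrow> (label \<Rightarrow> nat) \<Rightarrow> nat \<Rightarrow> int \<Rightarrow> label \<Rightarrow> bool" where
  "reaches jump children 0 k v \<longleftrightarrow> k \<le> 0"
| "reaches jump children (Suc m) k v \<longleftrightarrow>
     k \<le> 0 \<or> (\<exists>i<children v. reaches jump children m (k - jump v) (fst v, snd v @ [i]))"

text \<open>The recursion unrolled along a line of descent \<open>w\<close> below \<open>u\<close>.
  The jump of the last particle on it is not summed, in accordance with
  \<open>location\<close>.\<close>

lemma reaches_iff:
  "reaches jump children m k (i, u) \<longleftrightarrow>
    (\<exists>w. length w \<le> m \<and> (\<forall>l<length w. w ! l < children (i, u @ take l w))
      \<and> k \<le> (\<Sum>l<length w. jump (i, u @ take l w)))"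
proof (induction m arbitrary: k u)
  case 0
  then show ?case by auto
next
  case (Suc m)
  let ?P = "\<lambda>m k u w. length w \<le> m \<and> (\<forall>l<length w. w ! l < children (i, u @ take l w))
      \<and> k \<le> (\<Sum>l<length w. jump (i, u @ take l w))"
  have Cons: "?P (Suc m) k u (j # w) \<longleftrightarrow> j < children (i, u) \<and> ?P m (k - jump (i, u)) (u @ [j]) w" for j w
    by (auto simp: All_less_Suc2 sum.lessThan_Suc_shift algebra_simps simp del: sum.lessThan_Suc)
  have ex_list: "(\<exists>w. Q w) \<longleftrightarrow> Q [] \<or> (\<exists>j w. Q (j # w))" for Q :: "nat list \<Rightarrow> bool"
    by (metis list.exhaust)
  have "(\<exists>w. ?P (Suc m) k u w) \<longleftrightarrow> ?P (Suc m) k u [] \<or> (\<exists>j w. ?P (Suc m) k u (j # w))"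
    by (rule ex_list)
  also have "\<dots> \<longleftrightarrow> k \<le> 0 \<or> (\<exists>j<children (i, u). \<exists>w. ?P m (k - jump (i, u)) (u @ [j]) w)"
    unfolding Cons by auto
  also have "\<dots> \<longleftrightarrow> reaches jump children (Suc m) k (i, u)"
    using Suc.IH by simp
  finally show ?case by simp
qed

lemma reaches_mono: "reaches jump children m k v \<Longrightarrow> m \<le> m' \<Longrightarrow> reaches jump children m' k v"
  by (cases v) (force simp: reaches_iff)

lemma generation_iff:
  "(i, u) \<in> generation n children m \<longleftrightarrow>
    i < n \<and> length u = m \<and> (\<forall>l<m. u ! l < children (i, take l u))"
proof (induction m arbitrary: u)
  case 0
  then show ?case by auto
next
  case (Suc m)
  show ?case
  proof (cases u rule: rev_cases)
    case Nil
    then show ?thesis by auto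
  next
    case (snoc u' j)
    have "(i, u) \<in> generation n children (Suc m) \<longleftrightarrow> (i, u') \<in> generation n children m \<and> j < children (i, u')"
      by (auto simp: snoc)
    then show ?thesis
      unfolding Suc.IH by (auto simp: snoc All_less_Suc nth_append)
  qed
qed

text \<open>Locations are integers: if none attains the ceiling of \<open>r\<close>, all are at most
  the ceiling minus 1, and their supremum stays strictly below \<open>r\<close>.\<close>

lemma max_displacement_ge_iff:
  "ereal r \<le> max_displacement n jump children \<longleftrightarrow> (\<exists>m. \<exists>i<n. reaches jump children m \<lceil>r\<rceil> (i, []))"
proof
  assume *: "ereal r \<le> max_displacement n jump children"
  show "\<exists>m. \<exists>i<n. reaches jump children m \<lceil>r\<rceil> (i, [])"
  proof (rule ccontr)
    assume neg: "\<not> ?thesis"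
    have "location jump v \<le> \<lceil>r\<rceil> - 1" if v: "v \<in> generation n children m" for m v
    proof (rule ccontr)
      assume "\<not> ?thesis"
      moreover obtain i u where "v = (i, u)" by (cases v)
      ultimately have "i < n" "reaches jump children m \<lceil>r\<rceil> (i, [])"
        using v by (auto simp: reaches_iff generation_iff location_def intro!: exI[of _ u])
      with neg show False by blast
    qed
    then have "max_displacement n jump children \<le> ereal (real_of_int (\<lceil>r\<rceil> - 1))"
      unfolding max_displacement_def by (intro SUP_least) (simp del: of_int_diff)
    also have "\<dots> < ereal r" by simp linarith
    finally show False using * by simp
  qed
next
  assume "\<exists>m. \<exists>i<n. reaches jump children m \<lceil>r\<rceil> (i, [])"
  then obtain i w where w: "i < n" "\<forall>l<length w. w ! l < children (i, take l w)"
    "\<lceil>r\<rceil> \<le> (\<Sum>l<length w. jump (i, take l w))"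
    by (auto simp: reaches_iff)
  have "ereal r \<le> ereal (real_of_int (location jump (i, w)))"
    using w(3) by (simp add: location_def ceiling_le_iff)
  also have "\<dots> \<le> max_displacement n jump children"
    unfolding max_displacement_def using w by (intro SUP_upper2[of "length w"] SUP_upper) (auto simp: generation_iff)
  finally show "ereal r \<le> max_displacement n jump children" .
qed

section \<open>Hitting probabilities within \<open>m\<close> generations, given by the first-step
  recursion, and their limit\<close>

primrec hitting_prob :: "int pmf \<Rightarrow> nat pmf \<Rightarrow> nat \<Rightarrow> int \<Rightarrow> real" where
  "hitting_prob a p 0 k = (if k \<le> 0 then 1 else 0)"
| "hitting_prob a p (Suc m) k =
     (if k \<le> 0 then 1 else measure_pmf.expectation a (\<lambda>j. thinning p (hitting_prob a p m (k - j))))"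

lemma hitting_prob_bounds: "0 \<le> hitting_prob a p m k" "hitting_prob a p m k \<le> 1"
proof -
  have "0 \<le> hitting_prob a p m k \<and> hitting_prob a p m k \<le> 1"
  proof (induction m arbitrary: k)
    case (Suc m)
    have "integrable (measure_pmf a) (\<lambda>j. thinning p (hitting_prob a p m (k - j)))"
      by (rule integrable_thinning_comp) (use Suc in auto)
    then have "measure_pmf.expectation a (\<lambda>j. thinning p (hitting_prob a p m (k - j))) \<le> 1"
      using Suc by (intro measure_pmf.integral_le_const) (auto intro: thinning_le_1)
    moreover have "0 \<le> measure_pmf.expectation a (\<lambda>j. thinning p (hitting_prob a p m (k - j)))"
      using Suc by (intro integral_nonneg_AE AE_pmfI thinning_nonneg) auto
    ultimately show ?case by simp
  qed simp
  then show "0 \<le> hitting_prob a p m k" "hitting_prob a p m k \<le> 1" by auto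
qed

lemma integrable_thinning_hitting_prob:
  "integrable (measure_pmf a) (\<lambda>j. thinning p (hitting_prob a p m (k - j)))"
  by (rule integrable_thinning_comp) (rule hitting_prob_bounds)+

lemma hitting_prob_mono: "hitting_prob a p m k \<le> hitting_prob a p (Suc m) k"
proof (induction m arbitrary: k)
  case 0
  then show ?case by (auto intro!: integral_nonneg_AE thinning_nonneg)
next
  case (Suc m)
  have "measure_pmf.expectation a (\<lambda>j. thinning p (hitting_prob a p m (k - j)))
      \<le> measure_pmf.expectation a (\<lambda>j. thinning p (hitting_prob a p (Suc m) (k - j)))"
    by (intro integral_mono integrable_thinning_hitting_prob thinning_mono Suc hitting_prob_bounds)
  then show ?case unfolding hitting_prob.simps(2)[of a p m k] hitting_prob.simps(2)[of a p "Suc m" k]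
    by (simp del: hitting_prob.simps)
qed

lemma hitting_prob_antimono: "k \<le> l \<Longrightarrow> hitting_prob a p m l \<le> hitting_prob a p m k"
proof (induction m arbitrary: k l)
  case 0
  then show ?case by auto
next
  case (Suc m)
  have "hitting_prob a p (Suc m) l \<le> 1" by (rule hitting_prob_bounds)
  moreover have "measure_pmf.expectation a (\<lambda>j. thinning p (hitting_prob a p m (l - j)))
      \<le> measure_pmf.expectation a (\<lambda>j. thinning p (hitting_prob a p m (k - j)))"
    using Suc.prems
    by (intro integral_mono integrable_thinning_hitting_prob thinning_mono Suc.IH hitting_prob_bounds) simp
  ultimately show ?case using Suc.prems by auto
qed

definition hitting_prob_lim :: "int pmf \<Rightarrow> nat pmf \<Rightarrow> int \<Rightarrow> real" where
  "hitting_prob_lim a p k = (SUP m. hitting_prob a p m k)"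

lemma hitting_prob_tendsto: "(\<lambda>m. hitting_prob a p m k) \<longlonglongrightarrow> hitting_prob_lim a p k"
  unfolding hitting_prob_lim_def
  by (intro LIMSEQ_incseq_SUP bdd_aboveI[where M = 1] incseq_SucI) (auto simp: hitting_prob_bounds hitting_prob_mono simp del: hitting_prob.simps)

lemma hitting_prob_lim_bounds: "0 \<le> hitting_prob_lim a p k" "hitting_prob_lim a p k \<le> 1"
  using LIMSEQ_le_const[OF hitting_prob_tendsto] LIMSEQ_le_const2[OF hitting_prob_tendsto] hitting_prob_bounds
  by blast+

context critical_laws
begin

text \<open>The limit in \<open>m\<close> inherits bounds, monotonicity and boundary values; the
  recursion survives by continuity of \<open>thinning p\<close> and dominated convergence.\<close>

lemma hitting_prob_lim_asymptotics:
  "((\<lambda>k. (real_of_int k)\<^sup>2 * hitting_prob_lim a p k) \<longlongrightarrow> 6 * \<eta>2 / \<sigma>2) at_top"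
proof (rule solution_asymptotics)
  note lim = hitting_prob_tendsto[of a p]
  show bounds: "0 \<le> hitting_prob_lim a p k" "hitting_prob_lim a p k \<le> 1" for k
    by (rule hitting_prob_lim_bounds)+
  show "antimono (hitting_prob_lim a p)"
    by (intro antimonoI LIMSEQ_le[OF lim lim]) (auto intro: hitting_prob_antimono)
  show "hitting_prob_lim a p k = 1" if "k \<le> 0" for k
  proof (rule LIMSEQ_unique[OF lim])
    have "hitting_prob a p m k = 1" for m using that by (cases m) auto
    then show "(\<lambda>m. hitting_prob a p m k) \<longlonglongrightarrow> 1" by simp
  qed
  show "hitting_prob_lim a p k = measure_pmf.expectation a (\<lambda>j. thinning p (hitting_prob_lim a p (k - j)))"
    if "k > 0" for k
  proof (rule LIMSEQ_unique)
    show "(\<lambda>m. hitting_prob a p (Suc m) k) \<longlonglongrightarrow> hitting_prob_lim a p k"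
      using lim by (rule LIMSEQ_Suc)
    have "(\<lambda>m. thinning p (hitting_prob a p m l)) \<longlonglongrightarrow> thinning p (hitting_prob_lim a p l)" for l
      by (rule thinning_tendsto[OF lim bounds]) (rule hitting_prob_bounds)+
    then have "(\<lambda>m. measure_pmf.expectation a (\<lambda>j. thinning p (hitting_prob a p m (k - j))))
      \<longlonglongrightarrow> measure_pmf.expectation a (\<lambda>j. thinning p (hitting_prob_lim a p (k - j)))"
      by (intro integral_dominated_convergence[where w = "\<lambda>_. 1"] AE_pmfI)
        (simp_all add: abs_thinning_le_1 hitting_prob_bounds)
    moreover have "hitting_prob a p (Suc m) k
        = measure_pmf.expectation a (\<lambda>j. thinning p (hitting_prob a p m (k - j)))" for m
      using that by simp
    ultimately show "(\<lambda>m. hitting_prob a p (Suc m) k)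
      \<longlonglongrightarrow> measure_pmf.expectation a (\<lambda>j. thinning p (hitting_prob_lim a p (k - j)))"
      by (simp del: hitting_prob.simps)
  qed
qed

end

section \<open>Hitting events as measurable functions of the configuration of labels\<close>

definition reaches_in :: "(label \<Rightarrow> int \<times> nat) \<Rightarrow> nat \<Rightarrow> int \<Rightarrow> label \<Rightarrow> bool" where
  "reaches_in f = reaches (\<lambda>v. fst (f v)) (\<lambda>v. snd (f v))"

text \<open>Naming the value \<open>y\<close> of \<open>f v\<close> writes the event as a union over
  a countable type, with fixed parameters inside; measurability and the partition of the hitting
  event rest on this.\<close>

lemma reaches_in_Suc:
  "reaches_in f (Suc m) k v \<longleftrightarrow>
     k \<le> 0 \<or> (\<exists>y. f v = y \<and> (\<exists>i<snd y. reaches_in f m (k - fst y) (fst v, snd v @ [i])))"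
  by (simp add: reaches_in_def)

definition descendants :: "label \<Rightarrow> label set" where
  "descendants v = {(fst v, snd v @ w) | w. True}"

lemma descendants_refl: "v \<in> descendants v"
  by (auto simp: descendants_def intro!: exI[of _ "[]"] prod_eqI)

lemma descendants_child: "descendants (fst v, snd v @ [i]) \<subseteq> descendants v"
  by (auto simp: descendants_def)

lemma reaches_in_cong:
  "(\<And>x. x \<in> descendants v \<Longrightarrow> f x = g x) \<Longrightarrow> reaches_in f m k v = reaches_in g m k v"
proof (induction m arbitrary: k v)
  case 0
  then show ?case by (simp add: reaches_in_def)
next
  case (Suc m)
  have "reaches_in f m l (fst v, snd v @ [i]) = reaches_in g m l (fst v, snd v @ [i])" for l i
    using Suc.prems descendants_child by (intro Suc.IH) blast
  then show ?case using Suc.prems[OF descendants_refl] by (simp add: reaches_in_Suc)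
qed

lemma reaches_in_restrict: "reaches_in (restrict f (descendants v)) m k v = reaches_in f m k v"
  by (rule reaches_in_cong) simp

text \<open>The index set \<open>K\<close> is kept general so that the product space stays fixed
  while the induction descends to the smaller subtrees of the children.\<close>

lemma measurable_reaches_in:
  "descendants v \<subseteq> K \<Longrightarrow>
    Measurable.pred (PiM K (\<lambda>_. count_space UNIV)) (\<lambda>f. reaches_in f m k v)"
proof (induction m arbitrary: k v)
  case 0
  then show ?case by (simp add: reaches_in_def)
next
  case (Suc m)
  have [measurable]: "Measurable.pred (PiM K (\<lambda>_. count_space UNIV)) (\<lambda>f. reaches_in f m l (fst v, snd v @ [i]))" for l i
    using Suc.prems descendants_child by (intro Suc.IH) blast
  have "v \<in> K" using Suc.prems descendants_refl by blast
  then have [measurable]: "(\<lambda>f. f v) \<in> measurable (PiM K (\<lambda>_. count_space UNIV)) (count_space (UNIV :: (int \<times> nat) set))"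
    by (rule measurable_component_singleton)
  show ?case unfolding reaches_in_Suc by measurable
qed

section \<open>Independence over disjoint blocks of labels\<close>

context branching_random_walk
begin

abbreviation "config \<omega> \<equiv> \<lambda>v. (jump v \<omega>, children v \<omega>)"

lemma measurable_config: "v \<in> {..<n} \<times> UNIV \<Longrightarrow> (\<lambda>\<omega>. config \<omega> v) \<in> measurable M (count_space UNIV)"
  using indep by (auto simp: indep_vars_def)

lemma pred_reaches_in:
  assumes "fst v < n"
  shows "Measurable.pred M (\<lambda>\<omega>. reaches_in (config \<omega>) m k v)"
proof -
  have "(\<lambda>\<omega>. restrict (config \<omega>) (descendants v)) \<in> measurable M (PiM (descendants v) (\<lambda>_. count_space UNIV))"
    using assms by (intro measurable_restrict measurable_config) (auto simp: descendants_def)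
  from measurable_compose[OF this measurable_reaches_in[OF order_refl, where v = v and m = m and k = k]]
  have "Measurable.pred M (\<lambda>\<omega>. reaches_in (restrict (config \<omega>) (descendants v)) m k v)" .
  then show ?thesis unfolding reaches_in_restrict .
qed

lemma prob_config:
  assumes "fst v < n"
  shows "prob {\<omega> \<in> space M. config \<omega> v = y} = pmf (pair_pmf step offspring) y"
proof -
  have v: "v \<in> {..<n} \<times> UNIV" using assms by (cases v) auto
  have "pmf (pair_pmf step offspring) y = measure (distr M (count_space UNIV) (\<lambda>\<omega>. config \<omega> v)) {y}"
    unfolding law[OF v] by (simp add: pmf.rep_eq)
  also have "\<dots> = prob {\<omega> \<in> space M. config \<omega> v = y}"
    using measurable_config[OF v] by (subst measure_distr) (auto intro!: arg_cong[where f = prob])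
  finally show ?thesis by simp
qed

text \<open>Restrictions of an independent family to disjoint index sets are independent, and each
  \<open>Q j\<close> sees its own block only.\<close>

lemma prob_disjoint_blocks:
  assumes "finite L" "L \<noteq> {}"
    and K: "\<And>j. j \<in> L \<Longrightarrow> K j \<subseteq> {..<n} \<times> UNIV" "disjoint_family_on K L"
    and Q: "\<And>j. j \<in> L \<Longrightarrow> Measurable.pred (PiM (K j) (\<lambda>_. count_space UNIV)) (Q j)"
    and cong: "\<And>j f. j \<in> L \<Longrightarrow> Q j (restrict f (K j)) = Q j f"
  shows "prob {\<omega> \<in> space M. \<forall>j\<in>L. Q j (config \<omega>)} = (\<Prod>j\<in>L. prob {\<omega> \<in> space M. Q j (config \<omega>)})"
proof -
  have "indep_vars (\<lambda>j. PiM (K j) (\<lambda>_. count_space UNIV)) (\<lambda>j \<omega>. restrict (config \<omega>) (K j)) L"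
    using indep_vars_restrict[OF indep K] .
  then have *: "indep_vars (\<lambda>j. count_space UNIV) (\<lambda>j \<omega>. Q j (restrict (config \<omega>) (K j))) L"
    by (rule indep_vars_compose2) (rule Q)
  have vimage: "(\<lambda>\<omega>. Q j (restrict (config \<omega>) (K j))) -` {True} \<inter> space M = {\<omega> \<in> space M. Q j (config \<omega>)}"
    if "j \<in> L" for j
    using cong[OF that] by auto
  have "prob (\<Inter>j\<in>L. (\<lambda>\<omega>. Q j (restrict (config \<omega>) (K j))) -` {True} \<inter> space M)
      = (\<Prod>j\<in>L. prob ((\<lambda>\<omega>. Q j (restrict (config \<omega>) (K j))) -` {True} \<inter> space M))"
    using assms(1,2) by (intro indep_varsD[OF *]) auto
  also have "(\<Inter>j\<in>L. (\<lambda>\<omega>. Q j (restrict (config \<omega>) (K j))) -` {True} \<inter> space M)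
      = {\<omega> \<in> space M. \<forall>j\<in>L. Q j (config \<omega>)}"
    using \<open>L \<noteq> {}\<close> vimage by auto
  also have "(\<Prod>j\<in>L. prob ((\<lambda>\<omega>. Q j (restrict (config \<omega>) (K j))) -` {True} \<inter> space M))
      = (\<Prod>j\<in>L. prob {\<omega> \<in> space M. Q j (config \<omega>)})"
    by (intro prod.cong refl arg_cong[where f = prob] vimage)
  finally show ?thesis .
qed

end

lemma child_not_ancestor: "v \<notin> descendants (fst v, snd v @ [i])"
  by (auto simp: descendants_def prod_eq_iff)

lemma descendants_siblings_disjoint:
  "i \<noteq> j \<Longrightarrow> descendants (fst v, snd v @ [i]) \<inter> descendants (fst v, snd v @ [j]) = {}"
  by (auto simp: descendants_def)

context branching_random_walk
begin

lemma prob_not_reaches: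
  assumes "fst v < n"
  shows "prob {\<omega> \<in> space M. \<not> reaches_in (config \<omega>) m k v}
    = 1 - prob {\<omega> \<in> space M. reaches_in (config \<omega>) m k v}"
proof -
  have "{\<omega> \<in> space M. reaches_in (config \<omega>) m k v} \<in> events"
    using pred_reaches_in[OF assms] by (simp add: pred_def)
  from prob_compl[OF this] show ?thesis
    by (simp add: set_diff_eq cong: conj_cong)
qed

lemma pred_config: "fst v < n \<Longrightarrow> Measurable.pred M (\<lambda>\<omega>. config \<omega> v = y)"
  using measurable_config[of v] by (intro pred_eq_const1) (auto simp: mem_Times_iff)

text \<open>The pair at \<open>v\<close> and the subtrees of its children occupy disjoint sets of
  labels, so the probability factorises.\<close>

lemma prob_children_avoid:
  assumes v: "fst v < n"
    and IH: "\<And>i. prob {\<omega> \<in> space M. reaches_in (config \<omega>) m l (fst v, snd v @ [i])} = h"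
  shows "prob {\<omega> \<in> space M. config \<omega> v = y \<and> (\<forall>i<N. \<not> reaches_in (config \<omega>) m l (fst v, snd v @ [i]))}
    = pmf (pair_pmf step offspring) y * (1 - h) ^ N"
proof -
  \<comment> \<open>Block 0 is the label \<open>v\<close> alone, block \<open>i + 1\<close> the
    subtree of its child \<open>i\<close>.\<close>
  define K where "K = case_nat {v} (\<lambda>i. descendants (fst v, snd v @ [i]))"
  define Q where "Q = case_nat (\<lambda>f. f v = y) (\<lambda>i f. \<not> reaches_in f m l (fst v, snd v @ [i]))"
  have "prob {\<omega> \<in> space M. \<forall>j\<in>{..<Suc N}. Q j (config \<omega>)}
      = (\<Prod>j\<in>{..<Suc N}. prob {\<omega> \<in> space M. Q j (config \<omega>)})"
  proof (rule prob_disjoint_blocks)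
    show "K j \<subseteq> {..<n} \<times> UNIV" for j
      using v by (cases j) (auto simp: K_def descendants_def mem_Times_iff)
    show "disjoint_family_on K {..<Suc N}"
      unfolding disjoint_family_on_def
    proof (intro ballI impI)
      fix i j :: nat assume "i \<noteq> j"
      then show "K i \<inter> K j = {}"
        using child_not_ancestor[of v] descendants_siblings_disjoint[of _ _ v]
        by (cases i; cases j) (auto simp: K_def)
    qed
    show "Measurable.pred (PiM (K j) (\<lambda>_. count_space UNIV)) (Q j)" for j
    proof (cases j)
      case 0
      have "(\<lambda>f. f v) \<in> measurable (PiM {v} (\<lambda>_. count_space UNIV)) (count_space (UNIV :: (int \<times> nat) set))"
        by (rule measurable_component_singleton) simp
      then show ?thesis unfolding 0 K_def Q_def by (simp add: pred_eq_const1)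
    next
      case (Suc i)
      then show ?thesis
        unfolding K_def Q_def using measurable_reaches_in[OF order_refl] by simp
    qed
    show "Q j (restrict f (K j)) = Q j f" for j f
      by (cases j) (simp_all add: K_def Q_def reaches_in_restrict restrict_apply' del: restrict_apply)
  qed auto
  moreover have "{\<omega> \<in> space M. \<forall>j\<in>{..<Suc N}. Q j (config \<omega>)}
      = {\<omega> \<in> space M. config \<omega> v = y \<and> (\<forall>i<N. \<not> reaches_in (config \<omega>) m l (fst v, snd v @ [i]))}"
    by (simp add: Q_def Ball_def All_less_Suc2 del: lessThan_Suc)
  moreover have "prob {\<omega> \<in> space M. Q (Suc i) (config \<omega>)} = 1 - h" for i
    using prob_not_reaches[of "(fst v, snd v @ [i])"] v IH[of i] by (simp add: Q_def)
  moreover have "prob {\<omega> \<in> space M. Q 0 (config \<omega>)} = pmf (pair_pmf step offspring) y"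
    using prob_config[OF v] by (simp add: Q_def)
  ultimately show ?thesis
    by (simp add: prod.lessThan_Suc_shift del: prod.lessThan_Suc)
qed

text \<open>First-step analysis of the complement: for \<open>k > 0\<close>, failure within
  \<open>m + 1\<close> generations means that after the first pair every child's subtree fails to
  cover the remaining distance in \<open>m\<close> generations.\<close>

lemma prob_reaches:
  "fst v < n \<Longrightarrow> prob {\<omega> \<in> space M. reaches_in (config \<omega>) m k v} = hitting_prob step offspring m k"
proof (induction m arbitrary: k v)
  case 0
  then show ?case by (simp add: reaches_in_def prob_space)
next
  case (Suc m)
  show ?case
  proof (cases "k \<le> 0")
    case True
    then show ?thesis by (simp add: reaches_in_def prob_space)
  next
    case False
    let ?h = "\<lambda>d. hitting_prob step offspring m (k - d)"
    let ?c = "\<lambda>i. (fst v, snd v @ [i])"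
    \<comment> \<open>The failure event split by the value \<open>y\<close> of the pair at
      \<open>v\<close>; the parts are disjoint and countably many.\<close>
    define B where "B y = {\<omega> \<in> space M. config \<omega> v = y \<and>
        (\<forall>i<snd y. \<not> reaches_in (config \<omega>) m (k - fst y) (?c i))}" for y
    have prob_B: "prob (B y) = pmf (pair_pmf step offspring) y * (1 - ?h (fst y)) ^ snd y" for y
      unfolding B_def using Suc.prems by (intro prob_children_avoid Suc.IH) auto
    have [measurable]: "Measurable.pred M (\<lambda>\<omega>. config \<omega> v = y)" for y
      using pred_config Suc.prems by blast
    have [measurable]: "Measurable.pred M (\<lambda>\<omega>. reaches_in (config \<omega>) m l (?c i))" for l i
      using pred_reaches_in Suc.prems by simp
    have B_sets: "B y \<in> sets M" for y
      unfolding B_def by measurable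
    have h: "0 \<le> ?h d" "?h d \<le> 1" for d by (rule hitting_prob_bounds)+
    have "{\<omega> \<in> space M. \<not> reaches_in (config \<omega>) (Suc m) k v} = (\<Union>y. B y)"
      unfolding B_def reaches_in_Suc using False by auto
    then have "ennreal (prob {\<omega> \<in> space M. \<not> reaches_in (config \<omega>) (Suc m) k v}) = emeasure M (\<Union>y. B y)"
      by (simp add: emeasure_eq_measure)
    also have "\<dots> = (\<integral>\<^sup>+ y. emeasure M (B y) \<partial>count_space UNIV)"
      using B_sets by (intro emeasure_UN_countable) (auto simp: disjoint_family_on_def B_def)
    \<comment> \<open>The weights \<open>pmf (pair_pmf step offspring) y\<close> turn the sum over
      \<open>y\<close> into an integral against the product law, evaluated next by iterated
      integration.\<close>
    also have "\<dots> = (\<integral>\<^sup>+ y. ennreal ((1 - ?h (fst y)) ^ snd y) \<partial>pair_pmf step offspring)"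
      unfolding nn_integral_measure_pmf emeasure_eq_measure prob_B
      using h by (simp add: ennreal_mult)
    also have "\<dots> = (\<integral>\<^sup>+ d. \<integral>\<^sup>+ N. ennreal ((1 - ?h d) ^ N) \<partial>offspring \<partial>step)"
      by (simp add: nn_integral_pair_pmf')
    also have "\<dots> = (\<integral>\<^sup>+ d. ennreal (1 - thinning offspring (?h d)) \<partial>step)"
    proof (rule nn_integral_cong)
      fix d
      have "(\<integral>\<^sup>+ N. ennreal ((1 - ?h d) ^ N) \<partial>offspring)
          = ennreal (measure_pmf.expectation offspring (\<lambda>N. (1 - ?h d) ^ N))"
        using h[of d] by (intro nn_integral_eq_integral integrable_power_one_minus) auto
      then show "(\<integral>\<^sup>+ N. ennreal ((1 - ?h d) ^ N) \<partial>offspring) = ennreal (1 - thinning offspring (?h d))"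
        using thinning_eq[OF h] by simp
    qed
    also have "\<dots> = ennreal (measure_pmf.expectation step (\<lambda>d. 1 - thinning offspring (?h d)))"
      using h by (intro nn_integral_eq_integral Bochner_Integration.integrable_diff
          integrable_thinning_hitting_prob) (auto simp: thinning_le_1)
    also have "measure_pmf.expectation step (\<lambda>d. 1 - thinning offspring (?h d))
        = 1 - hitting_prob step offspring (Suc m) k"
      using False integrable_thinning_hitting_prob[of step offspring m k] by simp
    finally have "prob {\<omega> \<in> space M. \<not> reaches_in (config \<omega>) (Suc m) k v}
        = 1 - hitting_prob step offspring (Suc m) k"
      using hitting_prob_bounds(2)[of step offspring "Suc m" k]
      by (subst (asm) ennreal_inj) (auto simp del: hitting_prob.simps)
    then show ?thesis using prob_not_reaches[OF Suc.prems] by (simp del: hitting_prob.simps)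
  qed
qed

text \<open>Within \<open>m\<close> generations the trees of the \<open>n\<close> initial particles
  are disjoint blocks, so all fail with the \<open>n\<close>-th power of the single failure
  probability. The events increase with \<open>m\<close>, and continuity from below gives the
  limit.\<close>

lemma prob_max_displacement_ge:
  assumes "0 < n"
  shows "prob {\<omega> \<in> space M. ereal r \<le> max_displacement n (\<lambda>v. jump v \<omega>) (\<lambda>v. children v \<omega>)}
    = 1 - (1 - hitting_prob_lim step offspring \<lceil>r\<rceil>) ^ n"
proof -
  define E where "E m = {\<omega> \<in> space M. \<exists>i<n. reaches_in (config \<omega>) m \<lceil>r\<rceil> (i, [])}" for m
  have [measurable]: "Measurable.pred M (\<lambda>\<omega>. reaches_in (config \<omega>) m \<lceil>r\<rceil> (i, []))" if "i < n" for m i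
    using that pred_reaches_in by simp
  have E_sets: "E m \<in> events" for m
  proof -
    have "E m = (\<Union>i\<in>{..<n}. {\<omega> \<in> space M. reaches_in (config \<omega>) m \<lceil>r\<rceil> (i, [])})"
      by (auto simp: E_def)
    then show ?thesis by (auto intro!: sets.finite_UN)
  qed
  have "prob (E m) = 1 - (1 - hitting_prob step offspring m \<lceil>r\<rceil>) ^ n" for m
  proof -
    have "prob {\<omega> \<in> space M. \<forall>i\<in>{..<n}. \<not> reaches_in (config \<omega>) m \<lceil>r\<rceil> (i, [])}
        = (\<Prod>i\<in>{..<n}. prob {\<omega> \<in> space M. \<not> reaches_in (config \<omega>) m \<lceil>r\<rceil> (i, [])})"
    proof (rule prob_disjoint_blocks[where K = "\<lambda>i. descendants (i, [])"])
      show "Measurable.pred (PiM (descendants (i, [])) (\<lambda>_. count_space UNIV)) (\<lambda>f. \<not> reaches_in f m \<lceil>r\<rceil> (i, []))" for i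
        using measurable_reaches_in[OF order_refl] by simp
      show "(\<not> reaches_in (restrict f (descendants (i, []))) m \<lceil>r\<rceil> (i, [])) = (\<not> reaches_in f m \<lceil>r\<rceil> (i, []))" for i f
        by (simp add: reaches_in_restrict del: restrict_apply)
    qed (use assms in \<open>auto simp: descendants_def disjoint_family_on_def\<close>)
    also have "\<dots> = (1 - hitting_prob step offspring m \<lceil>r\<rceil>) ^ n"
      by (simp add: prob_not_reaches prob_reaches del: hitting_prob.simps)
    also have "{\<omega> \<in> space M. \<forall>i\<in>{..<n}. \<not> reaches_in (config \<omega>) m \<lceil>r\<rceil> (i, [])} = space M - E m"
      by (auto simp: E_def)
    finally show ?thesis using prob_compl[OF E_sets[of m]] by simp
  qed
  then have "(\<lambda>m. prob (E m)) \<longlonglongrightarrow> 1 - (1 - hitting_prob_lim step offspring \<lceil>r\<rceil>) ^ n"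
    by (simp only:) (intro tendsto_intros hitting_prob_tendsto)
  moreover have "(\<lambda>m. prob (E m)) \<longlonglongrightarrow> prob (\<Union>m. E m)"
  proof (rule finite_Lim_measure_incseq)
    show "range E \<subseteq> events" using E_sets by auto
    show "incseq E"
      by (auto simp: incseq_def E_def reaches_in_def dest: reaches_mono)
  qed
  ultimately have "prob (\<Union>m. E m) = 1 - (1 - hitting_prob_lim step offspring \<lceil>r\<rceil>) ^ n"
    by (rule LIMSEQ_unique[rotated])
  moreover have "(\<Union>m. E m) = {\<omega> \<in> space M. ereal r \<le> max_displacement n (\<lambda>v. jump v \<omega>) (\<lambda>v. children v \<omega>)}"
    by (auto simp: E_def max_displacement_ge_iff reaches_in_def)
  ultimately show ?thesis by simp
qed

end

section \<open>The exponential limit and the conclusion\<close>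

lemma power_one_minus_tendsto_exp:
  fixes q :: "nat \<Rightarrow> real"
  assumes q: "\<And>n. 0 \<le> q n" "\<And>n. q n \<le> 1" and lim: "(\<lambda>n. real n * q n) \<longlonglongrightarrow> z"
  shows "(\<lambda>n. (1 - q n) ^ n) \<longlonglongrightarrow> exp (- z)"
proof -
  have "(\<lambda>n. real n * q n * (1 / real n)) \<longlonglongrightarrow> z * 0"
    by (intro tendsto_mult lim lim_1_over_n)
  moreover have "eventually (\<lambda>n. real n * q n * (1 / real n) = q n) sequentially"
    using eventually_gt_at_top[of 0] by eventually_elim simp
  ultimately have "(\<lambda>n. q n) \<longlonglongrightarrow> z * 0" by (rule Lim_transform_eventually)
  then have "q \<longlonglongrightarrow> 0" by simp
  \<comment> \<open>The power lies between \<open>exp (- n * q / (1 - q))\<close> and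
    \<open>exp (- n * q)\<close>, and the two exponents have the same limit since \<open>q\<close>
    tends to 0.\<close>
  show ?thesis
  proof (rule tendsto_sandwich)
    have "(\<lambda>n. exp (- (real n * q n / (1 - q n)))) \<longlonglongrightarrow> exp (- (z / (1 - 0)))"
      using \<open>q \<longlonglongrightarrow> 0\<close> by (intro tendsto_intros lim) auto
    then show "(\<lambda>n. exp (- (real n * q n / (1 - q n)))) \<longlonglongrightarrow> exp (- z)" by simp
    show "(\<lambda>n. exp (- (real n * q n))) \<longlonglongrightarrow> exp (- z)"
      by (intro tendsto_intros lim)
    show "eventually (\<lambda>n. (1 - q n) ^ n \<le> exp (- (real n * q n))) sequentially"
    proof (intro always_eventually allI)
      fix n
      have "(1 - q n) ^ n \<le> exp (- q n) ^ n"
        using q exp_ge_add_one_self[of "- q n"] by (intro power_mono) auto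
      then show "(1 - q n) ^ n \<le> exp (- (real n * q n))"
        by (simp flip: exp_of_nat_mult)
    qed
    have "eventually (\<lambda>n. q n < 1) sequentially"
      using order_tendstoD(2)[OF \<open>q \<longlonglongrightarrow> 0\<close>, of 1] by simp
    then show "eventually (\<lambda>n. exp (- (real n * q n / (1 - q n))) \<le> (1 - q n) ^ n) sequentially"
    proof eventually_elim
      case (elim n)
      \<comment> \<open>The lower bound is \<open>1 + z \<le> exp z\<close> at
        \<open>z = q / (1 - q)\<close>, inverted.\<close>
      have "1 / (1 - q n) = 1 + q n / (1 - q n)" using elim by (simp add: field_simps)
      also have "\<dots> \<le> exp (q n / (1 - q n))" by (rule exp_ge_add_one_self)
      finally have "exp (- (q n / (1 - q n))) \<le> 1 - q n"
        using elim by (simp add: exp_minus field_simps)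
      then have "exp (- (q n / (1 - q n))) ^ n \<le> (1 - q n) ^ n"
        by (intro power_mono) auto
      then show ?case by (simp flip: exp_of_nat_mult)
    qed
  qed
qed

theorem corollary2:
  fixes a :: "int pmf" and p :: "nat pmf" and \<eta> \<sigma> r x :: real
    and \<Omega> :: "nat \<Rightarrow> 'w measure"
    and jump :: "nat \<Rightarrow> label \<Rightarrow> 'w \<Rightarrow> int"
    and children :: "nat \<Rightarrow> label \<Rightarrow> 'w \<Rightarrow> nat"
  assumes "r > 4"
    and "integrable (measure_pmf a) (\<lambda>k. \<bar>real_of_int k\<bar> powr r)"
    and "measure_pmf.expectation a real_of_int = 0"
    and "measure_pmf.variance a real_of_int = \<eta>\<^sup>2"
    and "\<eta>\<^sup>2 > 0"
    and "integrable (measure_pmf p) (\<lambda>k. real k ^ 3)"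
    and "measure_pmf.expectation p real = 1"
    and "measure_pmf.variance p real = \<sigma>\<^sup>2"
    and "\<sigma>\<^sup>2 > 0"
    and "\<And>n. branching_random_walk (\<Omega> n) a p n (jump n) (children n)"
    and "x > 0"
  shows "(\<lambda>n. measure (\<Omega> n) {\<omega> \<in> space (\<Omega> n).
            max_displacement n (\<lambda>v. jump n v \<omega>) (\<lambda>v. children n v \<omega>) \<ge> ereal (sqrt (real n) * x)})
         \<longlonglongrightarrow> 1 - exp (- (6 * \<eta>\<^sup>2 / \<sigma>\<^sup>2) / x\<^sup>2)"
proof -
  have "integrable (measure_pmf a) (\<lambda>k. real_of_int k ^ 4)"
  proof (rule Bochner_Integration.integrable_bound)
    show "integrable (measure_pmf a) (\<lambda>k. 1 + \<bar>real_of_int k\<bar> powr r)" using assms(2) by simp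
    \<comment> \<open>A nonzero integer has absolute value at least 1, so its fourth power is
      dominated by its \<open>r\<close>-th; the summand 1 keeps the bound nonnegative at 0.\<close>
    have "real_of_int k ^ 4 \<le> 1 + \<bar>real_of_int k\<bar> powr r" for k
    proof (cases "k = 0")
      case False
      then have "1 \<le> \<bar>real_of_int k\<bar>" by linarith
      then have "\<bar>real_of_int k\<bar> powr 4 \<le> \<bar>real_of_int k\<bar> powr r"
        using assms(1) by (intro powr_mono) auto
      moreover have "\<bar>real_of_int k\<bar> powr 4 = real_of_int k ^ 4"
        using False by (simp add: powr_numeral)
      ultimately show ?thesis by simp
    qed simp
    then show "AE k in measure_pmf a. norm (real_of_int k ^ 4) \<le> norm (1 + \<bar>real_of_int k\<bar> powr r)"
      by (intro AE_pmfI) auto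
  qed simp
  then interpret critical_laws a p "\<eta>\<^sup>2" "\<sigma>\<^sup>2"
    using assms by unfold_locales auto
  \<comment> \<open>The level that integer locations must attain. Then \<open>n * q\<close> is the
    product of \<open>k\<^sup>2 * q\<close> and \<open>n / k\<^sup>2\<close>, with limits
    \<open>6 * \<eta>\<^sup>2 / \<sigma>\<^sup>2\<close> and \<open>1 / x\<^sup>2\<close>.\<close>
  define k where "k n = \<lceil>sqrt (real n) * x\<rceil>" for n :: nat
  define q where "q n = hitting_prob_lim a p (k n)" for n
  have "filterlim (\<lambda>n. sqrt (real n) * x) at_top sequentially"
    using assms(11) by real_asymp
  then have k_lim: "filterlim k at_top sequentially"
    unfolding filterlim_at_top k_def
  proof (intro allI)
    fix Z :: int
    assume *: "\<forall>Z. eventually (\<lambda>n. Z \<le> sqrt (real n) * x) sequentially"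
    show "eventually (\<lambda>n. Z \<le> \<lceil>sqrt (real n) * x\<rceil>) sequentially"
      using *[rule_format, of "real_of_int Z"] by eventually_elim linarith
  qed
  have "(\<lambda>n. (real_of_int (k n))\<^sup>2 * q n) \<longlonglongrightarrow> 6 * \<eta>\<^sup>2 / \<sigma>\<^sup>2"
    unfolding q_def by (rule filterlim_compose[OF hitting_prob_lim_asymptotics k_lim])
  moreover have "(\<lambda>n. real n / (real_of_int (k n))\<^sup>2) \<longlonglongrightarrow> inverse (x\<^sup>2)"
    unfolding k_def using assms(11) by real_asymp
  ultimately have "(\<lambda>n. (real_of_int (k n))\<^sup>2 * q n * (real n / (real_of_int (k n))\<^sup>2))
      \<longlonglongrightarrow> 6 * \<eta>\<^sup>2 / \<sigma>\<^sup>2 * inverse (x\<^sup>2)"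
    by (rule tendsto_mult)
  moreover have "eventually (\<lambda>n. (real_of_int (k n))\<^sup>2 * q n * (real n / (real_of_int (k n))\<^sup>2) = real n * q n) sequentially"
    using k_lim[unfolded filterlim_at_top, rule_format, of 1] by eventually_elim simp
  ultimately have "(\<lambda>n. real n * q n) \<longlonglongrightarrow> 6 * \<eta>\<^sup>2 / \<sigma>\<^sup>2 * inverse (x\<^sup>2)"
    by (rule Lim_transform_eventually)
  then have "(\<lambda>n. real n * q n) \<longlonglongrightarrow> 6 * \<eta>\<^sup>2 / \<sigma>\<^sup>2 / x\<^sup>2"
    by (simp only: divide_inverse)
  moreover have "0 \<le> q n" "q n \<le> 1" for n
    unfolding q_def by (rule hitting_prob_lim_bounds)+
  ultimately have "(\<lambda>n. 1 - (1 - q n) ^ n) \<longlonglongrightarrow> 1 - exp (- (6 * \<eta>\<^sup>2 / \<sigma>\<^sup>2 / x\<^sup>2))"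
    by (intro tendsto_intros power_one_minus_tendsto_exp)
  moreover have "eventually (\<lambda>n. 1 - (1 - q n) ^ n = measure (\<Omega> n) {\<omega> \<in> space (\<Omega> n).
      max_displacement n (\<lambda>v. jump n v \<omega>) (\<lambda>v. children n v \<omega>) \<ge> ereal (sqrt (real n) * x)}) sequentially"
    \<comment> \<open>The exact formula is stated for at least one initial particle; the term
      \<open>n = 0\<close> does not affect the limit.\<close>
    using eventually_gt_at_top[of 0]
  proof eventually_elim
    case (elim n)
    interpret branching_random_walk "\<Omega> n" a p n "jump n" "children n" by (rule assms(10))
    show ?case unfolding q_def k_def by (rule prob_max_displacement_ge[OF elim, symmetric])
  qed
  ultimately show ?thesis
    unfolding minus_divide_left by (rule Lim_transform_eventually)
qed

end
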